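(* Let $r:\mathbb{R}^n\to\mathbb{R}^m$, $f(x)=\tfrac12\|r(x)\|^2$, and let $(x_k)$ be the iterates generated by the DFO-GN algorithm (described in the context). Suppose that: (i) there is $c_1\in[1/2,1]$ independent of $k$ such that every trust-region step $s_k$ satisfies $m_k(0)-m_k(s_k)\ge c_1\|g_k\|\min\left(\Delta_k,\frac{\|g_k\|}{\max(\|H_k\|,1)}\right)$; (ii) $r$ is $C^1$ and, on $\mathcal{B}$, the convex hull of $\bigcup_k B(x_k,\Delta_{max})$, its Jacobian $J$ is Lipschitz continuous with constant $L_J$, and $\|r(x)\|\le r_{max}$ and $\|J(x)\|\le J_{max}$ for all $x\in\mathcal{B}$; (iii) there is $\kappa_H\ge1$ such that $\|H_k\|\le\kappa_H$ for all $k$. Then $\lim_{k\to\infty}\|\nabla f(x_k)\|=0$.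
   Context: **Notation.** $\|\cdot\|$ is the Euclidean norm for vectors and the largest singular value for matrices; $B(x,\Delta)=\{y\in\mathbb{R}^n:\|y-x\|\le\Delta\}$; $J(x)\in\mathbb{R}^{m\times n}$ is the Jacobian of $r$. **Model.** Given $x_k$ and an interpolation set $Y_k=\{y_0,\dots,y_n\}\subset\mathbb{R}^n$ with $y_0=x_k$ and $y_1-x_k,\dots,y_n-x_k$ linearly independent, $J_k\in\mathbb{R}^{m\times n}$ is the unique matrix with $J_k(y_t-x_k)=r(y_t)-r(x_k)$, $t=1,\dots,n$, and $m_k(s)=\tfrac12\|r(x_k)+J_ks\|^2=f(x_k)+g_k^Ts+\tfrac12 s^TH_ks$ with $g_k=J_k^Tr(x_k)$, $H_k=J_k^TJ_k$. **$\Lambda$-poisedness.** The Lagrange polynomials of $Y_k$ are the affine functions $\Lambda_0,\dots,\Lambda_n$ with $\Lambda_l(y_t)=\delta_{l,t}$. $Y_k$ is $\Lambda$-poised in $B$ if $Y_k\subset B$ and $\max_t\max_{x\in B}|\Lambda_t(x)|\le\Lambda$. **DFO-GN algorithm.** Inputs: $x_0\in\mathbb{R}^n$, $\Delta_0^{init}>0$. Parameters: $\Delta_{max}\ge\Delta_0^{init}$, $\epsilon_C>0$, $\mu>0$, $0<\gamma_{dec}<1<\gamma_{inc}\le\overline\gamma_{inc}$, $0<\alpha_1<\alpha_2<1$, $0<\eta_1\le\eta_2<1$, $0<\omega_S<1$, $0<\omega_C<1$, $0<\gamma_S<2c_1/(1+\sqrt{1+2c_1})$, $\Lambda\ge1$.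 Choose $Y_0$ of size $n+1$ with $x_0\in Y_0$; set $\rho_0^{init}=\Delta_0^{init}$. For $k=0,1,2,\dots$: 1. Build the model $m_k^{init}$ (with gradient $g_k^{init}$ at $0$) from $x_k,Y_k$. 2. If $\|g_k^{init}\|\le\epsilon_C$ ( *criticality phase* ): for $i=1,2,\dots$, modify $Y_k$ (keeping $x_k$) until it is $\Lambda$-poised in $B(x_k,\omega_C^{i-1}\Delta_k^{init})$, rebuild the model with gradient $g_k^{(i)}$, and stop as soon as $\omega_C^{i-1}\Delta_k^{init}\le\mu\|g_k^{(i)}\|$, returning the current $Y_k$, the current model as $m_k$, and $\Delta_k=\omega_C^{i-1}\Delta_k^{init}$; set $\rho_k=\min(\rho_k^{init},\Delta_k)$. Otherwise set $m_k=m_k^{init}$, $\Delta_k=\Delta_k^{init}$, $\rho_k=\rho_k^{init}$. 3. Compute a step $s_k$ with $\|s_k\|\le\Delta_k$ approximately minimizing $m_k$ over $\|s\|\le\Delta_k$. 4. If $\|s_k\|<\gamma_S\rho_k$ ( *safety phase* ): set $x_{k+1}=x_k$, $\Delta_{k+1}^{init}=\max(\rho_k,\omega_S\Delta_k)$, form $Y_{k+1}$ by making $Y_k$ $\Lambda$-poised in $B(x_{k+1},\Delta_{k+1}^{init})$; then if $\Delta_{k+1}^{init}=\rho_k$ reset $(\rho_{k+1}^{init},\Delta_{k+1}^{init})=(\alpha_1\rho_k,\alpha_2\rho_k)$, otherwise $\rho_{k+1}^{init}=\rho_k$. Go to iteration $k+1$. 5. Otherwise compute $r_k=\frac{f(x_k)-f(x_k+s_k)}{m_k(0)-m_k(s_k)}$.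 Set $x_{k+1}=x_k+s_k$ if $r_k\ge\eta_1$, else $x_{k+1}=x_k$. Set $\Delta_{k+1}^{init}=\min(\max(\gamma_{inc}\Delta_k,\overline\gamma_{inc}\|s_k\|),\Delta_{max})$ if $r_k\ge\eta_2$; $\max(\gamma_{dec}\Delta_k,\|s_k\|,\rho_k)$ if $\eta_1\le r_k<\eta_2$; $\max(\min(\gamma_{dec}\Delta_k,\|s_k\|),\rho_k)$ if $r_k<\eta_1$. 6. If $r_k\ge\eta_1$ ( *successful* ): $Y_{k+1}=Y_k\cup\{x_{k+1}\}\setminus\{y_t\}$ for some $y_t\in Y_k$, $\rho_{k+1}^{init}=\rho_k$. Else, if $Y_k$ is not $\Lambda$-poised in $B(x_k,\Delta_k)$ ( *model-improving* ): form $Y_{k+1}$ by making $Y_k$ $\Lambda$-poised in $B(x_{k+1},\Delta_{k+1}^{init})$, $\rho_{k+1}^{init}=\rho_k$. Else ( *unsuccessful* ): $Y_{k+1}=Y_k$, and if $\Delta_{k+1}^{init}=\rho_k$ reset $(\rho_{k+1}^{init},\Delta_{k+1}^{init})=(\alpha_1\rho_k,\alpha_2\rho_k)$, otherwise $\rho_{k+1}^{init}=\rho_k$. It is understood that all interpolation systems encountered are solvable and that every criticality phase reached terminates, so that an infinite sequence of iterations is generated. *)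

theory Defs
  imports "HOL-Analysis.Analysis"
begin

section \<open>Norms and derivatives\<close>

definition singular_value :: "real^'n^'m \<Rightarrow> real \<Rightarrow> bool" where
  "singular_value A \<sigma> \<longleftrightarrow>
     0 \<le> \<sigma> \<and> (\<exists>u v. norm u = 1 \<and> norm v = 1 \<and>
       A *v v = \<sigma> *\<^sub>R u \<and> transpose A *v u = \<sigma> *\<^sub>R v)"

text \<open>The library's \<open>norm\<close> on \<open>real^'n^'m\<close> is the Frobenius norm, so the spectral norm
  needs its own constant. It coincides with the operator norm, see \<open>spec_norm_eq_onorm\<close>.\<close>

definition spec_norm :: "real^'n^'m \<Rightarrow> real" where
  "spec_norm A = (GREATEST \<sigma>. singular_value A \<sigma>)"

definition grad :: "('a::real_inner \<Rightarrow> real) \<Rightarrow> 'a \<Rightarrow> 'a" where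
  "grad f x = (THE g. GDERIV f x :> g)"

lemma spec_norm_eq_onorm:
  fixes A :: "real^'n^'m"
  shows "spec_norm A = onorm ((*v) A)"
proof -
  let ?K = "onorm ((*v) A)"
  have bl: "bounded_linear ((*v) A)" by simp
  have K0: "0 \<le> ?K" by (rule onorm_pos_le[OF bl])
  have le: "norm (A *v v) \<le> ?K * norm v" for v by (rule onorm[OF bl])
  have adj: "(A *v v) \<bullet> u = v \<bullet> (transpose A *v u)" for u v
    by (metis dot_lmul_matrix inner_commute transpose_matrix_vector)
  have le_t: "norm (transpose A *v u) \<le> ?K * norm u" for u
  proof (cases "transpose A *v u = 0")
    case False
    let ?w = "transpose A *v u"
    have "norm ?w * norm ?w = (A *v ?w) \<bullet> u"
      by (simp only: adj flip: power2_eq_square power2_norm_eq_inner)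
    also have "\<dots> \<le> norm (A *v ?w) * norm u" by (rule norm_cauchy_schwarz)
    also have "\<dots> \<le> (?K * norm ?w) * norm u" by (intro mult_right_mono le norm_ge_zero)
    finally have "norm ?w * norm ?w \<le> (?K * norm u) * norm ?w" by (simp add: mult_ac)
    then show ?thesis using False by simp
  qed (simp add: K0)
  have "singular_value A ?K"
  proof (cases "?K = 0")
    case True
    have z: "A *v v = 0" "transpose A *v u = 0" for u v
      using le[of v] le_t[of u] True by simp_all
    obtain u :: "real^'m" and v :: "real^'n" where "norm u = 1" "norm v = 1"
      by (meson norm_axis_1)
    then show ?thesis unfolding singular_value_def using z True by auto
  next
    case False
    have ne: "sphere (0::real^'n) 1 \<noteq> {}" by simp
    have cont: "continuous_on (sphere 0 1) (\<lambda>v. norm (A *v v))"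
      by (intro continuous_intros linear_continuous_on bl)
    obtain v where v: "norm v = 1" and mx: "\<And>w. norm w = 1 \<Longrightarrow> norm (A *v w) \<le> norm (A *v v)"
      using continuous_attains_sup[OF compact_sphere ne cont] by auto
    have "norm (A *v w) \<le> norm (A *v v) * norm w" for w
    proof (cases "w = 0")
      case False
      have "norm (A *v ((1 / norm w) *\<^sub>R w)) \<le> norm (A *v v)" by (rule mx) (use False in simp)
      then show ?thesis using False by (simp add: matrix_vector_mult_scaleR field_simps)
    qed simp
    then have "?K \<le> norm (A *v v)" by (intro onorm_le)
    then have Kv: "norm (A *v v) = ?K" using le[of v] v by simp
    define u where "u = (1 / ?K) *\<^sub>R (A *v v)"
    have u: "norm u = 1" and Av: "A *v v = ?K *\<^sub>R u"
      using Kv False K0 by (simp_all add: u_def)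
    let ?w = "transpose A *v u"
    have "?w \<bullet> v = ?K"
      using adj[of v u] u by (simp add: Av inner_commute flip: power2_norm_eq_inner)
    moreover have "(norm ?w)\<^sup>2 \<le> ?K\<^sup>2"
      using le_t[of u] u by (intro power_mono) auto
    moreover have "(norm (?w - ?K *\<^sub>R v))\<^sup>2 = (norm ?w)\<^sup>2 - 2 * ?K * (?w \<bullet> v) + ?K\<^sup>2 * (norm v)\<^sup>2"
      unfolding power2_norm_eq_inner
      by (simp add: inner_diff_left inner_diff_right inner_commute power2_eq_square algebra_simps)
    ultimately have "(norm (?w - ?K *\<^sub>R v))\<^sup>2 \<le> 0"
      using v by (simp add: power2_eq_square)
    then have "?w = ?K *\<^sub>R v" by simp
    then show ?thesis unfolding singular_value_def using K0 u v Av by blast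
  qed
  moreover have "\<sigma> \<le> ?K" if "singular_value A \<sigma>" for \<sigma>
  proof -
    obtain u v where "0 \<le> \<sigma>" "norm u = 1" "norm v = 1" "A *v v = \<sigma> *\<^sub>R u"
      using \<open>singular_value A \<sigma>\<close> by (auto simp: singular_value_def)
    with le[of v] show ?thesis by simp
  qed
  ultimately show ?thesis
    unfolding spec_norm_def by (rule Greatest_equality)
qed


section \<open>Interpolation sets and models\<close>

definition objective :: "(real^'n \<Rightarrow> real^'m) \<Rightarrow> real^'n \<Rightarrow> real" where
  "objective r z = 1/2 * (norm (r z))\<^sup>2"

text \<open>An interpolation set \<open>{y\<^sub>0, \<dots>, y\<^sub>n}\<close> is an unordered set together with its base
  point \<open>y\<^sub>0 = x\<close>.\<close>

definition interp_set :: "real^'n \<Rightarrow> (real^'n) set \<Rightarrow> bool" where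
  "interp_set x Y \<longleftrightarrow>
     finite Y \<and> card Y = CARD('n) + 1 \<and> x \<in> Y \<and> independent ((\<lambda>y. y - x) ` (Y - {x}))"

definition interp_jac :: "(real^'n \<Rightarrow> real^'m) \<Rightarrow> real^'n \<Rightarrow> (real^'n) set \<Rightarrow> real^'n^'m" where
  "interp_jac r x Y = (THE J. \<forall>y\<in>Y - {x}. J *v (y - x) = r y - r x)"

definition model :: "(real^'n \<Rightarrow> real^'m) \<Rightarrow> real^'n \<Rightarrow> (real^'n) set \<Rightarrow> real^'n \<Rightarrow> real" where
  "model r x Y s = 1/2 * (norm (r x + interp_jac r x Y *v s))\<^sup>2"

definition model_grad :: "(real^'n \<Rightarrow> real^'m) \<Rightarrow> real^'n \<Rightarrow> (real^'n) set \<Rightarrow> real^'n" where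
  "model_grad r x Y = transpose (interp_jac r x Y) *v r x"

definition model_hess :: "(real^'n \<Rightarrow> real^'m) \<Rightarrow> real^'n \<Rightarrow> (real^'n) set \<Rightarrow> real^'n^'n" where
  "model_hess r x Y = transpose (interp_jac r x Y) ** interp_jac r x Y"

definition lagrange_poly :: "(real^'n) set \<Rightarrow> real^'n \<Rightarrow> real^'n \<Rightarrow> real" where
  "lagrange_poly Y y =
     (THE L. (\<exists>c g. L = (\<lambda>z. c + g \<bullet> z)) \<and> (\<forall>z\<in>Y. L z = (if z = y then 1 else 0)))"

text \<open>Only meaningful for \<open>Y\<close> with \<open>interp_set x Y\<close> for some \<open>x\<close>, where the Lagrange
  polynomials exist and are unique.\<close>

definition poised :: "real \<Rightarrow> (real^'n) set \<Rightarrow> (real^'n) set \<Rightarrow> bool" where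
  "poised \<Lambda> Y B \<longleftrightarrow> Y \<subseteq> B \<and> (\<forall>y\<in>Y. \<forall>z\<in>B. \<bar>lagrange_poly Y y z\<bar> \<le> \<Lambda>)"


section \<open>The DFO-GN algorithm\<close>

record dfogn_params =
  Delta_max :: real
  eps_C :: real
  mu :: real
  gamma_dec :: real
  gamma_inc :: real
  gamma_inc_bar :: real
  alpha1 :: real
  alpha2 :: real
  eta1 :: real
  eta2 :: real
  omega_S :: real
  omega_C :: real
  gamma_S :: real
  Lambda :: real

definition valid_params :: "dfogn_params \<Rightarrow> real \<Rightarrow> bool" where
  "valid_params P c1 \<longleftrightarrow>
     eps_C P > 0 \<and> mu P > 0 \<and>
     0 < gamma_dec P \<and> gamma_dec P < 1 \<and> 1 < gamma_inc P \<and> gamma_inc P \<le> gamma_inc_bar P \<and>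
     0 < alpha1 P \<and> alpha1 P < alpha2 P \<and> alpha2 P < 1 \<and>
     0 < eta1 P \<and> eta1 P \<le> eta2 P \<and> eta2 P < 1 \<and>
     0 < omega_S P \<and> omega_S P < 1 \<and> 0 < omega_C P \<and> omega_C P < 1 \<and>
     0 < gamma_S P \<and> gamma_S P < 2 * c1 / (1 + sqrt (1 + 2 * c1)) \<and>
     Lambda P \<ge> 1"

text \<open>The procedure that makes a set \<open>\<Lambda>\<close>-poised is left unspecified: its result is any
  interpolation set based at \<open>x\<close> that is \<open>\<Lambda>\<close>-poised in \<open>B(x,\<Delta>)\<close>.\<close>

definition made_poised :: "dfogn_params \<Rightarrow> real^'n \<Rightarrow> real \<Rightarrow> (real^'n) set \<Rightarrow> bool" where
  "made_poised P x \<Delta> Y \<longleftrightarrow> interp_set x Y \<and> poised (Lambda P) Y (cball x \<Delta>)"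

text \<open>The criticality phase started at \<open>x\<close> with radius \<open>\<Delta>i\<close> stops, after finitely many
  rounds, with interpolation set \<open>Y\<close> and radius \<open>\<Delta>\<close>; \<open>Z i\<close> is the set of round \<open>i\<close>.\<close>

definition criticality ::
  "dfogn_params \<Rightarrow> (real^'n \<Rightarrow> real^'m) \<Rightarrow> real^'n \<Rightarrow> real \<Rightarrow> (real^'n) set \<Rightarrow> real \<Rightarrow> bool" where
  "criticality P r x \<Delta>i Y \<Delta> \<longleftrightarrow>
     (\<exists>Z N. N \<ge> 1 \<and>
        (\<forall>i\<in>{1..N}. made_poised P x (omega_C P ^ (i - 1) * \<Delta>i) (Z i)) \<and>
        (\<forall>i\<in>{1..<N}. \<not> omega_C P ^ (i - 1) * \<Delta>i \<le> mu P * norm (model_grad r x (Z i))) \<and>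
        omega_C P ^ (N - 1) * \<Delta>i \<le> mu P * norm (model_grad r x (Z N)) \<and>
        Y = Z N \<and> \<Delta> = omega_C P ^ (N - 1) * \<Delta>i)"

definition ratio :: "(real^'n \<Rightarrow> real^'m) \<Rightarrow> real^'n \<Rightarrow> (real^'n) set \<Rightarrow> real^'n \<Rightarrow> real" where
  "ratio r x Y s =
     (objective r x - objective r (x + s)) / (model r x Y 0 - model r x Y s)"

definition new_radius :: "dfogn_params \<Rightarrow> real \<Rightarrow> real \<Rightarrow> real \<Rightarrow> real \<Rightarrow> real" where
  "new_radius P q ns \<Delta> \<rho> =
     (if q \<ge> eta2 P then min (max (gamma_inc P * \<Delta>) (gamma_inc_bar P * ns)) (Delta_max P)
      else if q \<ge> eta1 P then max (max (gamma_dec P * \<Delta>) ns) \<rho>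
      else max (min (gamma_dec P * \<Delta>) ns) \<rho>)"

text \<open>Next initial values of \<open>(\<rho>, \<Delta>)\<close>, given \<open>\<rho>\<close> and the tentative new radius \<open>D\<close>.\<close>

definition reset_radii :: "dfogn_params \<Rightarrow> real \<Rightarrow> real \<Rightarrow> real \<times> real" where
  "reset_radii P \<rho> D = (if D = \<rho> then (alpha1 P * \<rho>, alpha2 P * \<rho>) else (\<rho>, D))"

text \<open>One iteration takes \<open>(x, Yi, \<rho>i, \<Delta>i)\<close>, the data at its start, to \<open>(x', Yi', \<rho>i', \<Delta>i')\<close>,
  the data at the start of the next one. \<open>Y\<close>, \<open>\<rho>\<close>, \<open>\<Delta>\<close> are the values after a possible
  criticality phase, and \<open>s\<close> is the step.\<close>

definition dfogn_iteration ::
  "dfogn_params \<Rightarrow> (real^'n \<Rightarrow> real^'m) \<Rightarrow>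
   real^'n \<Rightarrow> (real^'n) set \<Rightarrow> real \<Rightarrow> real \<Rightarrow>
   (real^'n) set \<Rightarrow> real \<Rightarrow> real \<Rightarrow> real^'n \<Rightarrow>
   real^'n \<Rightarrow> (real^'n) set \<Rightarrow> real \<Rightarrow> real \<Rightarrow> bool" where
  "dfogn_iteration P r x Yi \<rho>i \<Delta>i Y \<rho> \<Delta> s x' Yi' \<rho>i' \<Delta>i' \<longleftrightarrow>
     interp_set x Yi \<and>
     (if norm (model_grad r x Yi) \<le> eps_C P
      then criticality P r x \<Delta>i Y \<Delta> \<and> \<rho> = min \<rho>i \<Delta>
      else Y = Yi \<and> \<Delta> = \<Delta>i \<and> \<rho> = \<rho>i) \<and>
     norm s \<le> \<Delta> \<and>
     (if norm s < gamma_S P * \<rho>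
      then
        (let D = max \<rho> (omega_S P * \<Delta>) in
          x' = x \<and> made_poised P x' D Yi' \<and> (\<rho>i', \<Delta>i') = reset_radii P \<rho> D)
      else
        (let q = ratio r x Y s; D = new_radius P q (norm s) \<Delta> \<rho> in
          x' = (if q \<ge> eta1 P then x + s else x) \<and>
          (if q \<ge> eta1 P
           then (\<exists>y\<in>Y. Yi' = insert x' (Y - {y})) \<and> (\<rho>i', \<Delta>i') = (\<rho>, D)
           else if \<not> poised (Lambda P) Y (cball x \<Delta>)
           then made_poised P x' D Yi' \<and> (\<rho>i', \<Delta>i') = (\<rho>, D)
           else Yi' = Y \<and> (\<rho>i', \<Delta>i') = reset_radii P \<rho> D)))"

definition dfogn_run ::
  "dfogn_params \<Rightarrow> (real^'n \<Rightarrow> real^'m) \<Rightarrow>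
   (nat \<Rightarrow> real^'n) \<Rightarrow> (nat \<Rightarrow> (real^'n) set) \<Rightarrow> (nat \<Rightarrow> real) \<Rightarrow> (nat \<Rightarrow> real) \<Rightarrow>
   (nat \<Rightarrow> (real^'n) set) \<Rightarrow> (nat \<Rightarrow> real) \<Rightarrow> (nat \<Rightarrow> real) \<Rightarrow> (nat \<Rightarrow> real^'n) \<Rightarrow> bool" where
  "dfogn_run P r x Yi \<rho>i \<Delta>i Y \<rho> \<Delta> s \<longleftrightarrow>
     0 < \<Delta>i 0 \<and> \<Delta>i 0 \<le> Delta_max P \<and> \<rho>i 0 = \<Delta>i 0 \<and>
     (\<forall>k. dfogn_iteration P r (x k) (Yi k) (\<rho>i k) (\<Delta>i k) (Y k) (\<rho> k) (\<Delta> k) (s k)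
            (x (Suc k)) (Yi (Suc k)) (\<rho>i (Suc k)) (\<Delta>i (Suc k)))"

end

theory Submission
  imports Defs
begin

text \<open>On a \<open>\<Lambda>\<close>-poised set, every displacement of norm at most \<open>\<Delta>\<close> is a combination of the
  displacements \<open>y - x\<close> with coefficients the values of the Lagrange polynomials. Hence the
  interpolated Jacobian differs from the true one by \<open>O(\<Delta>)\<close>, the model gradient has error
  \<open>O(\<Delta>)\<close> and the model value has error \<open>O(\<Delta>\<^sup>2)\<close>. So a step is accepted as soon as \<open>\<Delta>\<close> is small
  compared with the model gradient, and the criticality phase makes the model gradient
  bounded away from zero wherever the true gradient is. If the true gradient stayed away from
  zero, \<open>\<rho>\<close> would be bounded below, so there would be finitely many successful iterations, and
  from then on \<open>\<rho> * \<Delta>\<close> would decrease geometrically, a contradiction; thus the gradient is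
  frequently small. Between an iterate with large gradient and the next one with small
  gradient, the path length is at most a constant times the decrease of the objective, which
  tends to zero; Lipschitz continuity of the gradient then gives the full limit.\<close>

section \<open>Matrix norms and the gradient of the objective\<close>

text \<open>Moving \<open>A\<close> across the inner product bounds the squared norm of
  \<open>transpose A *v u\<close> by a multiple of that norm, which cancels. The pointwise
  hypothesis serves both the spectral norm and the interpolation error.\<close>

lemma norm_transpose_vector_le:
  fixes A :: "real^'n^'m"
  assumes "\<And>v. norm (A *v v) \<le> K * norm v"
  shows "norm (transpose A *v u) \<le> K * norm u"
proof (cases "transpose A *v u = 0")
  case True
  have "0 \<le> K * norm (axis undefined 1 :: real^'n)"
    using assms norm_ge_zero order_trans by blast
  then have "0 \<le> K" by simp
  with True show ?thesis by simp
next
  case False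
  let ?w = "transpose A *v u"
  have "norm ?w * norm ?w = (A *v ?w) \<bullet> u"
    by (metis dot_lmul_matrix inner_commute power2_eq_square power2_norm_eq_inner
        transpose_matrix_vector)
  also have "\<dots> \<le> norm (A *v ?w) * norm u" by (rule norm_cauchy_schwarz)
  also have "\<dots> \<le> (K * norm ?w) * norm u" by (intro mult_right_mono assms norm_ge_zero)
  finally have "norm ?w * norm ?w \<le> (K * norm u) * norm ?w" by (simp add: mult_ac)
  then show ?thesis using False by simp
qed

lemma norm_matrix_vector_le_spec_norm:
  fixes A :: "real^'n^'m"
  shows "norm (A *v v) \<le> spec_norm A * norm v"
  unfolding spec_norm_eq_onorm by (rule onorm) simp

lemma GDERIV_objective:
  fixes r :: "real^'n \<Rightarrow> real^'m"
  assumes "r differentiable (at z)"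
  shows "GDERIV (objective r) z :> transpose (jacobian r (at z)) *v r z"
proof -
  have r: "(r has_derivative (*v) (jacobian r (at z))) (at z)"
    using assms jacobian_works by blast
  have "(objective r has_derivative
      (\<lambda>h. 1/2 * (r z \<bullet> (jacobian r (at z) *v h) + (jacobian r (at z) *v h) \<bullet> r z))) (at z)"
    unfolding objective_def[abs_def] power2_norm_eq_inner
    by (rule has_derivative_mult_right has_derivative_inner r)+
  moreover have "1/2 * (r z \<bullet> (jacobian r (at z) *v h) + (jacobian r (at z) *v h) \<bullet> r z)
      = h \<bullet> (transpose (jacobian r (at z)) *v r z)" for h
  proof -
    have "r z \<bullet> (jacobian r (at z) *v h) = h \<bullet> (transpose (jacobian r (at z)) *v r z)"
      by (metis dot_lmul_matrix inner_commute transpose_matrix_vector)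
    then show ?thesis by (simp add: inner_commute)
  qed
  ultimately show ?thesis
    unfolding gderiv_def by simp
qed

lemma grad_objective:
  fixes r :: "real^'n \<Rightarrow> real^'m"
  assumes "r differentiable (at z)"
  shows "grad (objective r) z = transpose (jacobian r (at z)) *v r z"
  unfolding grad_def
proof (rule the_equality)
  show "GDERIV (objective r) z :> transpose (jacobian r (at z)) *v r z"
    using assms by (rule GDERIV_objective)
  fix g assume "GDERIV (objective r) z :> g"
  then have "(\<lambda>h. h \<bullet> g) = (\<lambda>h. h \<bullet> (transpose (jacobian r (at z)) *v r z))"
    using GDERIV_objective[OF assms] unfolding gderiv_def by (rule has_derivative_unique)
  then have "\<forall>h. h \<bullet> g = h \<bullet> (transpose (jacobian r (at z)) *v r z)" by metis
  then show "g = transpose (jacobian r (at z)) *v r z" by (simp add: vector_eq_ldot)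
qed

section \<open>Linear interpolation\<close>

lemma interp_set_span:
  fixes x :: "real^'n"
  assumes "interp_set x Y"
  shows "span ((\<lambda>y. y - x) ` (Y - {x})) = UNIV"
proof -
  let ?B = "(\<lambda>y. y - x) ` (Y - {x})"
  have "card ?B = CARD('n)"
    using assms by (subst card_image) (auto simp: interp_set_def inj_on_def)
  then show ?thesis
    using assms card_ge_dim_independent[of ?B UNIV] by (auto simp: interp_set_def)
qed

lemma interp_set_linear_eqI:
  fixes x :: "real^'n"
  assumes "interp_set x Y" "linear F" "linear G" "\<And>y. y \<in> Y \<Longrightarrow> F (y - x) = G (y - x)"
  shows "F = G"
proof
  fix v
  show "F v = G v"
    by (rule linear_eq_on[OF assms(2,3), of v "(\<lambda>y. y - x) ` (Y - {x})"])
      (use assms(4) interp_set_span[OF assms(1)] in auto)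
qed

text \<open>Independence allows arbitrary values on the displacements; subtracting
  \<open>v x\<close> makes them consistent at \<open>y = x\<close>. Both \<open>interp_jac\<close>
  and the Lagrange polynomials come from this.\<close>

lemma interp_set_linear_extend:
  fixes x :: "real^'n" and v :: "real^'n \<Rightarrow> 'b::real_vector"
  assumes "interp_set x Y"
  obtains F where "linear F" "\<And>y. y \<in> Y \<Longrightarrow> F (y - x) = v y - v x"
proof -
  let ?B = "(\<lambda>y. y - x) ` (Y - {x})"
  have "independent ?B" using assms by (simp add: interp_set_def)
  from linear_independent_extend[OF this, of "\<lambda>b. v (x + b) - v x"]
  obtain F where F: "linear F" "\<forall>b\<in>?B. F b = v (x + b) - v x" by blast
  have "F (y - x) = v y - v x" if "y \<in> Y" for y
  proof (cases "y = x")
    case True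
    then show ?thesis using linear_0[OF F(1)] by simp
  next
    case False
    then show ?thesis using F(2) that by auto
  qed
  with F(1) show ?thesis by (rule that)
qed

text \<open>The description is proper: linear extension gives existence, the spanning displacements
  give uniqueness.\<close>

lemma interp_jac:
  fixes x :: "real^'n" and r :: "real^'n \<Rightarrow> real^'m"
  assumes I: "interp_set x Y" and "y \<in> Y"
  shows "interp_jac r x Y *v (y - x) = r y - r x"
proof -
  obtain F where F: "linear F" "\<And>y. y \<in> Y \<Longrightarrow> F (y - x) = r y - r x"
    using interp_set_linear_extend[OF I, of r] by blast
  have "\<exists>!A. \<forall>y\<in>Y - {x}. A *v (y - x) = r y - r x"
  proof (rule ex1I)
    show "\<forall>y\<in>Y - {x}. matrix F *v (y - x) = r y - r x"
      using F by (simp add: matrix_works)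
    fix A :: "real^'n^'m"
    assume A: "\<forall>y\<in>Y - {x}. A *v (y - x) = r y - r x"
    have "(*v) A = F"
    proof (rule interp_set_linear_eqI[OF I matrix_vector_mul_linear F(1)])
      fix y assume "y \<in> Y"
      then show "A *v (y - x) = F (y - x)"
        using A F linear_0[OF F(1)] by (cases "y = x") auto
    qed
    then show "A = matrix F" by (metis matrix_of_matrix_vector_mul)
  qed
  from theI'[OF this] show ?thesis
    using \<open>y \<in> Y\<close> by (cases "y = x") (auto simp: interp_jac_def)
qed

text \<open>An affine function is fixed by its linear part and its value at \<open>x\<close>, so
  existence and uniqueness carry over from linear maps.\<close>

lemma lagrange_poly:
  fixes x :: "real^'n"
  assumes I: "interp_set x Y"
  shows "\<exists>c g. lagrange_poly Y y = (\<lambda>z. c + g \<bullet> z)"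
    and "z \<in> Y \<Longrightarrow> lagrange_poly Y y z = (if z = y then 1 else 0)"
proof -
  let ?v = "\<lambda>z. if z = y then 1 else 0 :: real"
  obtain F where F: "linear F" "\<And>z. z \<in> Y \<Longrightarrow> F (z - x) = ?v z - ?v x"
    using interp_set_linear_extend[OF I, of ?v] by blast
  have "x \<in> Y" using I by (simp add: interp_set_def)
  \<comment> \<open>\<open>h\<close> is the adjoint of \<open>F\<close> at 1, the vector that
    represents the functional \<open>F\<close>.\<close>
  obtain h where inner: "F w = h \<bullet> w" for w
    using adjoint_works[OF F(1), of _ 1] by (metis inner_commute inner_real_def mult_1)
  have "\<exists>!L. (\<exists>c g. L = (\<lambda>z. c + g \<bullet> z)) \<and> (\<forall>z\<in>Y. L z = ?v z)"
  proof (rule ex1I, rule conjI)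
    let ?L = "\<lambda>z. (?v x - h \<bullet> x) + h \<bullet> z"
    show "\<exists>c g. ?L = (\<lambda>z. c + g \<bullet> z)" by blast
    show "\<forall>z\<in>Y. ?L z = ?v z"
    proof
      fix z assume "z \<in> Y"
      from F(2)[OF this] show "?L z = ?v z"
        unfolding inner inner_diff_right by linarith
    qed
    fix L assume L: "(\<exists>c g. L = (\<lambda>z. c + g \<bullet> z)) \<and> (\<forall>z\<in>Y. L z = ?v z)"
    then obtain c g where cg: "L = (\<lambda>z. c + g \<bullet> z)" by blast
    have "(\<bullet>) g = F"
    proof (rule interp_set_linear_eqI[OF I _ F(1)])
      show "linear ((\<bullet>) g)" by (simp add: bounded_linear.linear bounded_linear_inner_right)
      fix z assume "z \<in> Y"
      then have "c + g \<bullet> z = ?v z" "c + g \<bullet> x = ?v x" using L cg \<open>x \<in> Y\<close> by auto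
      then have "g \<bullet> (z - x) = ?v z - ?v x" by (simp only: inner_diff_right)
      then show "g \<bullet> (z - x) = F (z - x)" using F(2)[OF \<open>z \<in> Y\<close>] by simp
    qed
    then have "g \<bullet> z = h \<bullet> z" for z using inner by metis
    moreover have "c + g \<bullet> x = ?v x" using L cg \<open>x \<in> Y\<close> by auto
    ultimately show "L = ?L" unfolding cg by fastforce
  qed
  from theI'[OF this]
  show "\<exists>c g. lagrange_poly Y y = (\<lambda>z. c + g \<bullet> z)"
    and "z \<in> Y \<Longrightarrow> lagrange_poly Y y z = (if z = y then 1 else 0)"
    unfolding lagrange_poly_def by blast+
qed

text \<open>Once the values at \<open>x\<close> are subtracted, both sides are linear in
  \<open>d\<close> and agree on the spanning displacements.\<close>

lemma lagrange_poly_reproduces: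
  fixes x :: "real^'n"
  assumes I: "interp_set x Y"
  shows "(\<Sum>y\<in>Y. lagrange_poly Y y (x + d) *\<^sub>R (y - x)) = d"
proof -
  let ?L = "lagrange_poly Y"
  have fin: "finite Y" and "x \<in> Y" using I by (simp_all add: interp_set_def)
  have "linear (\<lambda>d. ?L y (x + d) - ?L y x)" for y
  proof -
    obtain c g where cg: "?L y = (\<lambda>z. c + g \<bullet> z)" using lagrange_poly(1)[OF I] by blast
    show ?thesis unfolding cg
      by (simp add: inner_add_right bounded_linear.linear bounded_linear_inner_right)
  qed
  then have "linear (\<lambda>d. (\<Sum>y\<in>Y. (?L y (x + d) - ?L y x) *\<^sub>R (y - x)))" (is "linear ?F")
    by (intro linear_compose_sum ballI linear_compose[OF _ linear_scaleR_left, unfolded o_def])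
  moreover have "?F (z - x) = id (z - x)" if "z \<in> Y" for z
  proof -
    have "?F (z - x) = (\<Sum>y\<in>Y. if y = z then y - x else 0)"
      by (rule sum.cong) (use that \<open>x \<in> Y\<close> in \<open>auto simp: lagrange_poly(2)[OF I]\<close>)
    then show ?thesis using fin that by simp
  qed
  ultimately have "?F = id"
    using interp_set_linear_eqI[OF I, of ?F id] linear_id by blast
  then have "(\<Sum>y\<in>Y. (?L y (x + d) - ?L y x) *\<^sub>R (y - x)) = d"
    by (simp add: fun_eq_iff)
  \<comment> \<open>The subtracted value is nonzero only for \<open>y = x\<close>, where its vector
    \<open>y - x\<close> vanishes.\<close>
  moreover have "(\<Sum>y\<in>Y. (?L y (x + d) - ?L y x) *\<^sub>R (y - x)) =
      (\<Sum>y\<in>Y. ?L y (x + d) *\<^sub>R (y - x))"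
    by (rule sum.cong) (use \<open>x \<in> Y\<close> in \<open>auto simp: lagrange_poly(2)[OF I]\<close>)
  ultimately show ?thesis by simp
qed

section \<open>Error of linear interpolation on poised sets\<close>

lemma poised_norm_le:
  fixes x :: "real^'n" and A :: "real^'n^'m"
  assumes I: "interp_set x Y" and p: "poised l Y (cball x D)" and "0 < D"
    and b: "\<And>y. y \<in> Y \<Longrightarrow> norm (A *v (y - x)) \<le> b"
  shows "norm (A *v d) \<le> (real CARD('n) + 1) * l * b / D * norm d"
proof (cases "d = 0")
  case False
  \<comment> \<open>Rescaling \<open>d\<close> to length \<open>D\<close> puts \<open>x + e\<close>
    in the ball where poisedness applies; undoing it gives the factor \<open>norm d / D\<close>. The
    factor n + 1 counts the terms of the sum.\<close>
  define e where "e = (D / norm d) *\<^sub>R d"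
  have "x \<in> Y" "card Y = CARD('n) + 1" using I by (simp_all add: interp_set_def)
  have "0 \<le> b" using b[OF \<open>x \<in> Y\<close>] by simp
  have e: "x + e \<in> cball x D" using False \<open>0 < D\<close> by (simp add: e_def dist_norm)
  have "A *v e = (\<Sum>y\<in>Y. lagrange_poly Y y (x + e) *\<^sub>R (A *v (y - x)))"
    by (subst lagrange_poly_reproduces[OF I, symmetric, of e])
      (simp add: linear_sum[OF matrix_vector_mul_linear] matrix_vector_mult_scaleR o_def)
  also have "norm \<dots> \<le> (\<Sum>y\<in>Y. l * b)"
  proof (rule sum_norm_le)
    fix y assume "y \<in> Y"
    have "norm (lagrange_poly Y y (x + e) *\<^sub>R (A *v (y - x)))
        = \<bar>lagrange_poly Y y (x + e)\<bar> * norm (A *v (y - x))" by simp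
    also have "\<dots> \<le> l * b"
    proof (rule mult_mono)
      show l: "\<bar>lagrange_poly Y y (x + e)\<bar> \<le> l" using p e \<open>y \<in> Y\<close> unfolding poised_def by blast
      show "0 \<le> l" using l by linarith
    qed (use b[OF \<open>y \<in> Y\<close>] in auto)
    finally show "norm (lagrange_poly Y y (x + e) *\<^sub>R (A *v (y - x))) \<le> l * b" .
  qed
  also have "\<dots> = (real CARD('n) + 1) * l * b" using \<open>card Y = _\<close> by simp
  finally have "norm (A *v e) \<le> (real CARD('n) + 1) * l * b" .
  moreover have "norm (A *v e) = D / norm d * norm (A *v d)"
    using \<open>0 < D\<close> by (simp add: e_def matrix_vector_mult_scaleR)
  ultimately show ?thesis using False \<open>0 < D\<close> by (simp add: field_simps)
qed simp

text \<open>The quadratic term of the Gauss--Newton model is nonnegative, so no curvature term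
  appears.\<close>

lemma model_decrease_le:
  "model r x Y 0 - model r x Y s \<le> norm (model_grad r x Y) * norm s"
proof -
  let ?J = "interp_jac r x Y"
  have "model r x Y 0 - model r x Y s = - (r x \<bullet> (?J *v s)) - 1/2 * (norm (?J *v s))\<^sup>2"
    unfolding model_def power2_norm_eq_inner
    by (simp add: inner_add_left inner_add_right inner_commute field_simps)
  also have "\<dots> \<le> \<bar>r x \<bullet> (?J *v s)\<bar>"
    using zero_le_power2[of "norm (?J *v s)"] by linarith
  also have "r x \<bullet> (?J *v s) = model_grad r x Y \<bullet> s"
    unfolding model_grad_def by (metis dot_lmul_matrix transpose_matrix_vector)
  also have "\<bar>\<dots>\<bar> \<le> norm (model_grad r x Y) * norm s" by (rule Cauchy_Schwarz_ineq2)
  finally show ?thesis .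
qed

lemma model_zero: "model r x Y 0 = objective r x"
  by (simp add: model_def objective_def)

text \<open>A mean value estimate for the linearization at \<open>x\<close>. The constant is
  \<open>L\<close>, not \<open>L / 2\<close>, because the variation of the derivative is bounded
  uniformly along the segment.\<close>

lemma taylor_jacobian:
  fixes r :: "real^'n \<Rightarrow> real^'m"
  assumes "convex S" and d: "\<And>z. z \<in> S \<Longrightarrow> r differentiable (at z)"
    and L: "\<And>y z. y \<in> S \<Longrightarrow> z \<in> S \<Longrightarrow>
      spec_norm (jacobian r (at y) - jacobian r (at z)) \<le> L * norm (y - z)"
    and "0 \<le> L" "x \<in> S" "z \<in> S"
  shows "norm (r z - r x - jacobian r (at x) *v (z - x)) \<le> L * (norm (z - x))\<^sup>2"
proof -
  \<comment> \<open>On this convex set the Lipschitz bound becomes the single constant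
    \<open>L * norm (z - x)\<close>.\<close>
  let ?T = "S \<inter> cball x (norm (z - x))"
  have "convex ?T" using \<open>convex S\<close> by (intro convex_Int convex_cball)
  moreover have "x \<in> ?T" "z \<in> ?T" using assms by (auto simp: dist_norm norm_minus_commute)
  ultimately have seg: "x + t *\<^sub>R (z - x) \<in> ?T" if "t \<in> {0..1}" for t
    using that convexD_alt[of ?T x z t] by (simp add: algebra_simps)
  have "norm (r z - r x - jacobian r (at x) *v (z - x)) \<le> norm (z - x) * (L * norm (z - x))"
  proof (rule differentiable_bound_linearization[where S = ?T and f' = "\<lambda>y. (*v) (jacobian r (at y))"])
    fix y assume y: "y \<in> ?T"
    then show "(r has_derivative (*v) (jacobian r (at y))) (at y within ?T)"
      using d jacobian_works has_derivative_at_withinI by blast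
    have "norm (y - x) \<le> norm (z - x)" using y by (simp add: dist_norm norm_minus_commute)
    then have "L * norm (y - x) \<le> L * norm (z - x)" using \<open>0 \<le> L\<close> by (rule mult_left_mono)
    then show "onorm ((*v) (jacobian r (at y)) - (*v) (jacobian r (at x))) \<le> L * norm (z - x)"
      using L[of y x] y \<open>x \<in> S\<close>
      by (simp add: spec_norm_eq_onorm fun_diff_def flip: matrix_vector_mult_diff_rdistrib)
  qed (use seg \<open>x \<in> ?T\<close> in auto)
  then show ?thesis by (simp add: power2_eq_square mult_ac)
qed

text \<open>At each \<open>y - x\<close> the interpolation condition turns the matrix difference
  into a Taylor remainder of size \<open>L * D\<^sup>2\<close>; the bound for poised sets divides
  out one \<open>D\<close>.\<close>

lemma interp_jac_error:
  fixes r :: "real^'n \<Rightarrow> real^'m"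
  assumes S: "convex S" "\<And>z. z \<in> S \<Longrightarrow> r differentiable (at z)"
    "\<And>y z. y \<in> S \<Longrightarrow> z \<in> S \<Longrightarrow>
      spec_norm (jacobian r (at y) - jacobian r (at z)) \<le> L * norm (y - z)"
    and "0 \<le> L" "cball x D \<subseteq> S"
    and I: "interp_set x Y" and p: "poised l Y (cball x D)" and "0 < D"
  shows "norm ((jacobian r (at x) - interp_jac r x Y) *v d) \<le> (real CARD('n) + 1) * l * L * D * norm d"
proof -
  have "x \<in> S" using \<open>cball x D \<subseteq> S\<close> \<open>0 < D\<close> by auto
  have "norm ((jacobian r (at x) - interp_jac r x Y) *v (y - x)) \<le> L * D\<^sup>2" if "y \<in> Y" for y
  proof -
    have y: "y \<in> cball x D" using p that by (auto simp: poised_def)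
    have "norm ((jacobian r (at x) - interp_jac r x Y) *v (y - x))
        = norm (r y - r x - jacobian r (at x) *v (y - x))"
      using interp_jac[OF I that, of r]
      by (simp add: matrix_vector_mult_diff_rdistrib norm_minus_commute)
    also have "\<dots> \<le> L * (norm (y - x))\<^sup>2"
      using S \<open>0 \<le> L\<close> \<open>x \<in> S\<close> y \<open>cball x D \<subseteq> S\<close> by (intro taylor_jacobian[where S = S]) auto
    also have "\<dots> \<le> L * D\<^sup>2"
      using y \<open>0 \<le> L\<close> by (intro mult_left_mono power_mono) (auto simp: dist_norm norm_minus_commute)
    finally show ?thesis .
  qed
  from poised_norm_le[OF I p \<open>0 < D\<close> this, of d]
  show ?thesis using \<open>0 < D\<close> by (simp add: power2_eq_square mult_ac)
qed

text \<open>Only \<open>a\<close> and the difference enter the bound: \<open>a\<close> will be the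
  true residual, bounded by \<open>r_max\<close>, and \<open>b\<close> the model residual.\<close>

lemma half_square_norm_diff_le:
  fixes a b :: "'a::real_inner"
  shows "\<bar>1/2 * (norm a)\<^sup>2 - 1/2 * (norm b)\<^sup>2\<bar> \<le> norm (a - b) * (norm a + norm (a - b))"
proof -
  have "1/2 * (norm a)\<^sup>2 - 1/2 * (norm b)\<^sup>2 = (a - b) \<bullet> a - 1/2 * (norm (a - b))\<^sup>2"
    unfolding power2_norm_eq_inner
    by (simp add: inner_diff_left inner_diff_right inner_commute field_simps)
  moreover have "\<bar>(a - b) \<bullet> a\<bar> \<le> norm (a - b) * norm a" by (rule Cauchy_Schwarz_ineq2)
  moreover have "0 \<le> (norm (a - b))\<^sup>2" by simp
  ultimately show ?thesis unfolding distrib_left power2_eq_square by linarith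
qed

section \<open>Analysis of the algorithm\<close>

text \<open>The setting in the form the analysis uses: a uniform \<kappa>_H in the Cauchy decrease,
  any convex set containing the trust-region balls, a nonnegative Lipschitz constant.\<close>

locale dfogn =
  fixes r :: "real^'n \<Rightarrow> real^'m"
    and P :: dfogn_params
    and x s :: "nat \<Rightarrow> real^'n"
    and Yi Y :: "nat \<Rightarrow> (real^'n) set"
    and \<rho>i \<Delta>i \<rho> \<Delta> :: "nat \<Rightarrow> real"
    and c1 L r_max J_max \<kappa>_H :: real
    and \<B> :: "(real^'n) set"
  assumes params: "valid_params P c1"
    and run: "dfogn_run P r x Yi \<rho>i \<Delta>i Y \<rho> \<Delta> s"
    and c1: "1/2 \<le> c1" "c1 \<le> 1"
    and decrease: "\<And>k. model r (x k) (Y k) 0 - model r (x k) (Y k) (s k)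
        \<ge> c1 * norm (model_grad r (x k) (Y k)) *
            min (\<Delta> k) (norm (model_grad r (x k) (Y k)) / \<kappa>_H)"
    and convex_B: "convex \<B>"
    and ball_B: "\<And>k. cball (x k) (Delta_max P) \<subseteq> \<B>"
    and r_diff: "\<And>z. r differentiable (at z)"
    and L_nonneg: "0 \<le> L"
    and J_lipschitz: "\<And>y z. y \<in> \<B> \<Longrightarrow> z \<in> \<B> \<Longrightarrow>
        spec_norm (jacobian r (at y) - jacobian r (at z)) \<le> L * norm (y - z)"
    and r_bound: "\<And>z. z \<in> \<B> \<Longrightarrow> norm (r z) \<le> r_max"
    and J_bound: "\<And>z. z \<in> \<B> \<Longrightarrow> spec_norm (jacobian r (at z)) \<le> J_max"
    and \<kappa>_H: "1 \<le> \<kappa>_H"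
begin

abbreviation J where "J z \<equiv> jacobian r (at z)"
abbreviation f where "f \<equiv> objective r"
abbreviation g where "g k \<equiv> model_grad r (x k) (Y k)"
abbreviation \<nu> where "\<nu> k \<equiv> norm (grad f (x k))"

section \<open>Form of an iteration and invariants of the radii\<close>

lemma param_bounds:
  "eps_C P > 0" "mu P > 0" "0 < gamma_dec P" "gamma_dec P < 1" "1 < gamma_inc P"
  "0 < alpha1 P" "alpha1 P < alpha2 P" "alpha2 P < 1" "0 < eta1 P" "eta1 P \<le> eta2 P"
  "eta2 P < 1" "0 < omega_S P" "omega_S P < 1" "0 < omega_C P" "omega_C P < 1"
  "0 < gamma_S P" "Lambda P \<ge> 1"
  using params by (auto simp: valid_params_def)

text \<open>The denominator in the bound on \<open>gamma_S P\<close> is at least 2. Hence a safety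
  step is shorter than \<open>c1 * \<rho> k\<close>.\<close>

lemma gamma_S_less: "gamma_S P < c1"
proof -
  have "1 \<le> sqrt (1 + 2 * c1)" using c1 by simp
  then have "2 * c1 / (1 + sqrt (1 + 2 * c1)) \<le> 2 * c1 / 2"
    using c1(1) by (intro divide_left_mono mult_pos_pos) linarith+
  then show ?thesis using params by (simp add: valid_params_def)
qed

lemma iteration:
  "dfogn_iteration P r (x k) (Yi k) (\<rho>i k) (\<Delta>i k) (Y k) (\<rho> k) (\<Delta> k) (s k)
     (x (Suc k)) (Yi (Suc k)) (\<rho>i (Suc k)) (\<Delta>i (Suc k))"
  using run by (simp add: dfogn_run_def)

lemma start_cases:
  obtains "Y k = Yi k" "\<Delta> k = \<Delta>i k" "\<rho> k = \<rho>i k" "eps_C P < norm (g k)"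
    | "criticality P r (x k) (\<Delta>i k) (Y k) (\<Delta> k)" "\<rho> k = min (\<rho>i k) (\<Delta> k)"
  using iteration[of k] unfolding dfogn_iteration_def by (auto split: if_splits)

lemma step_cases:
  obtains
    (safety) "norm (s k) < gamma_S P * \<rho> k" "x (Suc k) = x k"
      "made_poised P (x (Suc k)) (max (\<rho> k) (omega_S P * \<Delta> k)) (Yi (Suc k))"
      "(\<rho>i (Suc k), \<Delta>i (Suc k)) = reset_radii P (\<rho> k) (max (\<rho> k) (omega_S P * \<Delta> k))"
  | (successful) "gamma_S P * \<rho> k \<le> norm (s k)" "eta1 P \<le> ratio r (x k) (Y k) (s k)"
      "x (Suc k) = x k + s k" "\<rho>i (Suc k) = \<rho> k"
      "\<Delta>i (Suc k) = new_radius P (ratio r (x k) (Y k) (s k)) (norm (s k)) (\<Delta> k) (\<rho> k)"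
  | (improving) "gamma_S P * \<rho> k \<le> norm (s k)" "ratio r (x k) (Y k) (s k) < eta1 P"
      "x (Suc k) = x k" "\<not> poised (Lambda P) (Y k) (cball (x k) (\<Delta> k))" "\<rho>i (Suc k) = \<rho> k"
      "\<Delta>i (Suc k) = max (min (gamma_dec P * \<Delta> k) (norm (s k))) (\<rho> k)"
      "made_poised P (x (Suc k)) (\<Delta>i (Suc k)) (Yi (Suc k))"
  | (unsuccessful) "gamma_S P * \<rho> k \<le> norm (s k)" "ratio r (x k) (Y k) (s k) < eta1 P"
      "x (Suc k) = x k" "poised (Lambda P) (Y k) (cball (x k) (\<Delta> k))"
      "(\<rho>i (Suc k), \<Delta>i (Suc k)) =
        reset_radii P (\<rho> k) (max (min (gamma_dec P * \<Delta> k) (norm (s k))) (\<rho> k))"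
proof -
  let ?q = "ratio r (x k) (Y k) (s k)"
  have rad: "new_radius P ?q (norm (s k)) (\<Delta> k) (\<rho> k)
      = max (min (gamma_dec P * \<Delta> k) (norm (s k))) (\<rho> k)" if "?q < eta1 P"
    using that param_bounds(10) by (simp add: new_radius_def)
  note it = iteration[of k, unfolded dfogn_iteration_def Let_def]
  consider "norm (s k) < gamma_S P * \<rho> k"
    | "\<not> norm (s k) < gamma_S P * \<rho> k" "eta1 P \<le> ?q"
    | "\<not> norm (s k) < gamma_S P * \<rho> k" "\<not> eta1 P \<le> ?q"
      "\<not> poised (Lambda P) (Y k) (cball (x k) (\<Delta> k))"
    | "\<not> norm (s k) < gamma_S P * \<rho> k" "\<not> eta1 P \<le> ?q"
      "poised (Lambda P) (Y k) (cball (x k) (\<Delta> k))"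
    by blast
  then show ?thesis
  proof cases
    case 1
    from it show ?thesis
      unfolding if_P[OF 1] using safety[OF 1] by blast
  next
    case 2
    show ?thesis by (rule successful) (use 2 it in simp_all)
  next
    case 3
    show ?thesis by (rule improving) (use 3 it rad in auto)
  next
    case 4
    show ?thesis by (rule unsuccessful) (use 4 it rad in simp_all)
  qed
qed

lemma norm_s_le: "norm (s k) \<le> \<Delta> k"
  using iteration[of k] by (simp add: dfogn_iteration_def)

lemma interp_set_Y: "interp_set (x k) (Y k)"
proof (cases rule: start_cases[of k])
  case 1
  then show ?thesis using iteration[of k] by (simp add: dfogn_iteration_def)
next
  case 2
  then show ?thesis by (auto simp: criticality_def made_poised_def)
qed

lemma criticalityD:
  assumes c: "criticality P r (x k) D (Y k) D'" and "0 < D"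
  shows "0 < D'" "D' \<le> D" "poised (Lambda P) (Y k) (cball (x k) D')" "D' \<le> mu P * norm (g k)"
proof -
  obtain Z N where N: "N \<ge> 1" "\<forall>i\<in>{1..N}. made_poised P (x k) (omega_C P ^ (i - 1) * D) (Z i)"
    "omega_C P ^ (N - 1) * D \<le> mu P * norm (model_grad r (x k) (Z N))"
    "Y k = Z N" "D' = omega_C P ^ (N - 1) * D"
    using c unfolding criticality_def by blast
  show "0 < D'" using N(5) \<open>0 < D\<close> param_bounds by simp
  show "D' \<le> D" unfolding N(5)
    using \<open>0 < D\<close> param_bounds by (intro mult_left_le_one_le power_le_one) auto
  show "poised (Lambda P) (Y k) (cball (x k) D')" using N by (auto simp: made_poised_def)
  show "D' \<le> mu P * norm (g k)" using N by simp
qed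

lemma new_radius_bounds:
  assumes "0 < R" "R \<le> D" "D \<le> Delta_max P" "n \<le> D"
  shows "R \<le> new_radius P q n D R" "new_radius P q n D R \<le> Delta_max P"
proof -
  define u v where "u = gamma_inc P * D" and "v = gamma_dec P * D"
  have "D \<le> u" "v \<le> D"
    using assms param_bounds by (auto simp: u_def v_def)
  then show "R \<le> new_radius P q n D R" "new_radius P q n D R \<le> Delta_max P"
    using assms unfolding new_radius_def u_def[symmetric] v_def[symmetric]
    by (auto simp: min_def max_def)
qed

lemma mid_radii:
  assumes "0 < \<rho>i k" "\<rho>i k \<le> \<Delta>i k"
  shows "0 < \<rho> k" "\<rho> k \<le> \<Delta> k" "\<rho> k \<le> \<rho>i k" "\<Delta> k \<le> \<Delta>i k"
  using assms by (cases rule: start_cases[of k]; auto dest: criticalityD)+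

lemma start_radii: "0 < \<rho>i k \<and> \<rho>i k \<le> \<Delta>i k \<and> \<Delta>i k \<le> Delta_max P"
proof (induction k)
  case 0
  show ?case using run by (simp add: dfogn_run_def)
next
  case (Suc k)
  have mid: "0 < \<rho> k" "\<rho> k \<le> \<Delta> k" "\<Delta> k \<le> Delta_max P"
    using mid_radii[of k] Suc by auto
  \<comment> \<open>Shared by the safety and unsuccessful cases; \<open>alpha1 < alpha2 < 1\<close>
    preserves the ordering of the radii.\<close>
  have reset: "0 < a \<and> a \<le> b \<and> b \<le> Delta_max P"
    if "(a, b) = reset_radii P (\<rho> k) D" "\<rho> k \<le> D" "D \<le> \<Delta> k" for a b D
  proof -
    have "alpha1 P * \<rho> k \<le> alpha2 P * \<rho> k" "alpha2 P * \<rho> k \<le> \<rho> k" "0 < alpha1 P * \<rho> k"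
      using param_bounds mid by (auto intro!: mult_right_mono mult_left_le_one_le)
    moreover have "a = alpha1 P * \<rho> k \<and> b = alpha2 P * \<rho> k \<or> a = \<rho> k \<and> b = D"
      using that(1) by (simp add: reset_radii_def split: if_splits)
    ultimately show ?thesis using that(2,3) mid by linarith
  qed
  have "omega_S P * \<Delta> k \<le> \<Delta> k" "gamma_dec P * \<Delta> k \<le> \<Delta> k"
    using param_bounds mid by (auto intro!: mult_left_le_one_le)
  then have le: "max (\<rho> k) (omega_S P * \<Delta> k) \<le> \<Delta> k"
    "max (min (gamma_dec P * \<Delta> k) (norm (s k))) (\<rho> k) \<le> \<Delta> k"
    using mid unfolding max.bounded_iff min_le_iff_disj by blast+
  show ?case
  proof (cases rule: step_cases[of k])
    case safety
    show ?thesis by (rule reset[OF safety(4) max.cobounded1 le(1)])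
  next
    case successful
    then show ?thesis
      using new_radius_bounds[of "\<rho> k" "\<Delta> k" "norm (s k)" "ratio r (x k) (Y k) (s k)"]
        norm_s_le[of k] mid by auto
  next
    case improving
    then show ?thesis using le(2) mid max.cobounded2 by auto
  next
    case unsuccessful
    show ?thesis by (rule reset[OF unsuccessful(5) max.cobounded2 le(2)])
  qed
qed

lemma radii:
  "0 < \<rho>i k" "\<rho>i k \<le> \<Delta>i k" "\<Delta>i k \<le> Delta_max P"
  "0 < \<rho> k" "\<rho> k \<le> \<Delta> k" "\<rho> k \<le> \<rho>i k" "\<Delta> k \<le> \<Delta>i k" "0 < \<Delta> k" "\<Delta> k \<le> Delta_max P"
  using start_radii[of k] mid_radii[of k] by auto

lemma criticality_k:
  assumes "criticality P r (x k) (\<Delta>i k) (Y k) (\<Delta> k)"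
  shows "poised (Lambda P) (Y k) (cball (x k) (\<Delta> k))" "\<Delta> k \<le> mu P * norm (g k)"
  using criticalityD[OF assms] radii[of k] by auto

text \<open>Without a criticality phase the norm exceeds \<open>eps_C P\<close>; after one, the exit
  test bounds it below by a positive radius over \<open>mu P\<close>.\<close>

lemma g_pos: "0 < norm (g k)"
proof (cases rule: start_cases[of k])
  case 1
  then show ?thesis using param_bounds(1) by linarith
next
  case 2
  then show ?thesis using criticality_k(2)[of k] radii(8)[of k] by auto
qed

lemma x_in_B: "x k \<in> \<B>"
  using ball_B[of k] radii[of k] by auto

lemma r_max_nonneg: "0 \<le> r_max"
  using r_bound[OF x_in_B[of 0]] norm_ge_zero order_trans by blast

subsection \<open>Accuracy of the model on a poised set\<close>

definition \<kappa>_J :: real where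
  "\<kappa>_J = (real CARD('n) + 1) * Lambda P * L"

text \<open>One constant for both errors: the second summand bounds the gradient error, the third
  the model value error, and the 1 makes it positive.\<close>

definition \<kappa> :: real where
  "\<kappa> = 1 + \<kappa>_J * r_max + (\<kappa>_J + L) * (r_max + (\<kappa>_J + L) * (Delta_max P)\<^sup>2)"

lemma \<kappa>_J_nonneg: "0 \<le> \<kappa>_J"
  unfolding \<kappa>_J_def using param_bounds L_nonneg by (intro mult_nonneg_nonneg) auto

lemma \<kappa>_pos: "0 < \<kappa>" and \<kappa>_J_r_max_le: "\<kappa>_J * r_max \<le> \<kappa>"
  and \<kappa>_model_le: "(\<kappa>_J + L) * (r_max + (\<kappa>_J + L) * (Delta_max P)\<^sup>2) \<le> \<kappa>"
proof -
  have "0 \<le> \<kappa>_J * r_max" "0 \<le> (\<kappa>_J + L) * (r_max + (\<kappa>_J + L) * (Delta_max P)\<^sup>2)"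
    using \<kappa>_J_nonneg L_nonneg r_max_nonneg by auto
  then show "0 < \<kappa>" "\<kappa>_J * r_max \<le> \<kappa>"
    "(\<kappa>_J + L) * (r_max + (\<kappa>_J + L) * (Delta_max P)\<^sup>2) \<le> \<kappa>"
    unfolding \<kappa>_def by linarith+
qed

text \<open>\<open>Z\<close> is not fixed to be \<open>Y k\<close>: the radius bound for the
  criticality phase applies the gradient error to the set of an earlier round.\<close>

context
  fixes k Z D
  assumes Z: "made_poised P (x k) D Z" and D: "0 < D" "D \<le> Delta_max P"
begin

lemma jac_error: "norm ((J (x k) - interp_jac r (x k) Z) *v d) \<le> \<kappa>_J * D * norm d"
proof -
  have "cball (x k) D \<subseteq> \<B>" using ball_B[of k] D(2) by auto
  then show ?thesis
    using Z D interp_jac_error[OF convex_B r_diff J_lipschitz L_nonneg, of "x k" D Z "Lambda P" d]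
    by (simp add: \<kappa>_J_def made_poised_def)
qed

lemma grad_error: "norm (grad f (x k) - model_grad r (x k) Z) \<le> \<kappa> * D"
proof -
  have "grad f (x k) - model_grad r (x k) Z
      = transpose (J (x k) - interp_jac r (x k) Z) *v r (x k)"
    by (simp add: grad_objective[OF r_diff] model_grad_def transpose_def matrix_vector_mult_def
        vec_eq_iff left_diff_distrib sum_subtractf)
  also have "norm \<dots> \<le> \<kappa>_J * D * norm (r (x k))"
    using jac_error by (rule norm_transpose_vector_le)
  also have "\<dots> \<le> \<kappa>_J * D * r_max"
    using r_bound[OF x_in_B] \<kappa>_J_nonneg D by (intro mult_left_mono) auto
  also have "\<dots> \<le> \<kappa> * D"
    using \<kappa>_J_r_max_le D by (simp add: mult.assoc mult.commute[of D] mult_right_mono flip: mult.assoc)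
  finally show ?thesis .
qed

text \<open>The residual error is a Taylor remainder plus the Jacobian error applied to
  \<open>d\<close>, both of order \<open>D\<^sup>2\<close>; the other factor of the half-square
  bound stays bounded since \<open>D \<le> Delta_max P\<close>.\<close>

lemma model_error:
  assumes "norm d \<le> D"
  shows "\<bar>f (x k + d) - model r (x k) Z d\<bar> \<le> \<kappa> * D\<^sup>2"
proof -
  let ?A = "interp_jac r (x k) Z" and ?z = "x k + d"
  have z: "?z \<in> \<B>" using ball_B[of k] D assms by (auto simp: dist_norm)
  have "r ?z - (r (x k) + ?A *v d) = (r ?z - r (x k) - J (x k) *v d) + (J (x k) - ?A) *v d"
    by (simp add: matrix_vector_mult_diff_rdistrib)
  also have "norm \<dots> \<le> L * (norm d)\<^sup>2 + \<kappa>_J * D * norm d"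
    using taylor_jacobian[OF convex_B r_diff J_lipschitz L_nonneg x_in_B[of k] z] jac_error[of d]
    by (intro norm_triangle_mono) auto
  also have "\<dots> \<le> L * D\<^sup>2 + \<kappa>_J * D * D"
    using assms D L_nonneg \<kappa>_J_nonneg
    by (intro add_mono mult_left_mono power_mono) auto
  finally have e: "norm (r ?z - (r (x k) + ?A *v d)) \<le> (\<kappa>_J + L) * D\<^sup>2" (is "?e \<le> _")
    by (simp add: power2_eq_square algebra_simps)
  have "\<bar>f ?z - model r (x k) Z d\<bar> \<le> ?e * (norm (r ?z) + ?e)"
    unfolding objective_def model_def by (rule half_square_norm_diff_le)
  also have "\<dots> \<le> ((\<kappa>_J + L) * D\<^sup>2) * (r_max + (\<kappa>_J + L) * (Delta_max P)\<^sup>2)"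
  proof (intro mult_mono add_mono e r_bound[OF z])
    show "?e \<le> (\<kappa>_J + L) * (Delta_max P)\<^sup>2"
      using e D \<kappa>_J_nonneg L_nonneg
      by (elim order_trans) (intro mult_left_mono power_mono; simp)
  qed (use \<kappa>_J_nonneg L_nonneg in auto)
  also have "\<dots> \<le> \<kappa> * D\<^sup>2"
    using mult_right_mono[OF \<kappa>_model_le, of "D\<^sup>2"] by (simp add: mult_ac)
  finally show ?thesis .
qed

end

lemma made_poised_Y:
  "poised (Lambda P) (Y k) (cball (x k) (\<Delta> k)) \<Longrightarrow> made_poised P (x k) (\<Delta> k) (Y k)"
  using interp_set_Y by (simp add: made_poised_def)

text \<open>The model decrease lies between the Cauchy decrease and
  \<open>norm (g k) * norm (s k)\<close>; the positive gradient norm cancels.\<close>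

lemma norm_s_ge: "c1 * min (\<Delta> k) (norm (g k) / \<kappa>_H) \<le> norm (s k)"
proof -
  have "norm (g k) * (c1 * min (\<Delta> k) (norm (g k) / \<kappa>_H)) \<le> norm (g k) * norm (s k)"
    using decrease[of k] model_decrease_le[of r "x k" "Y k" "s k"] by (simp add: mult_ac)
  then show ?thesis using g_pos[of k] by (simp only: mult_le_cancel_left_pos)
qed

subsection \<open>Acceptance of the step\<close>

text \<open>For radii up to \<open>c0 * norm (g k)\<close>, the first entry makes the radius the
  smaller term of the Cauchy decrease, and the second makes the model error at most the fraction
  \<open>1 - eta1 P\<close> of the decrease.\<close>

definition c0 :: real where
  "c0 = min (1 / \<kappa>_H) (c1 * (1 - eta1 P) / \<kappa>)"

lemma c0_pos: "0 < c0"
  using \<kappa>_H c1 param_bounds \<kappa>_pos by (simp add: c0_def)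

text \<open>The model is exact at 0, so the actual and predicted decreases differ only by the model
  error at \<open>s k\<close>, which \<open>c0\<close> controls.\<close>

lemma accept:
  assumes p: "poised (Lambda P) (Y k) (cball (x k) (\<Delta> k))" and "\<Delta> k \<le> c0 * norm (g k)"
  shows "eta1 P \<le> ratio r (x k) (Y k) (s k)"
proof -
  define m where "m = model r (x k) (Y k) 0 - model r (x k) (Y k) (s k)"
  have "\<Delta> k \<le> norm (g k) / \<kappa>_H"
    using assms(2) mult_right_mono[of c0 "1 / \<kappa>_H" "norm (g k)"] by (simp add: c0_def)
  then have m: "c1 * norm (g k) * \<Delta> k \<le> m"
    using decrease[of k] by (simp add: m_def min_def)
  moreover have "0 < c1 * norm (g k) * \<Delta> k"
    using c1 g_pos[of k] radii(8)[of k] by (intro mult_pos_pos) auto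
  ultimately have "0 < m" by linarith
  have "\<kappa> * \<Delta> k \<le> \<kappa> * (c1 * (1 - eta1 P) / \<kappa> * norm (g k))"
    using assms(2) mult_right_mono[of c0 "c1 * (1 - eta1 P) / \<kappa>" "norm (g k)"] \<kappa>_pos
    by (intro mult_left_mono) (auto simp: c0_def)
  also have "\<dots> = c1 * (1 - eta1 P) * norm (g k)" using \<kappa>_pos by simp
  finally have "\<kappa> * \<Delta> k * \<Delta> k \<le> c1 * (1 - eta1 P) * norm (g k) * \<Delta> k"
    using radii(8)[of k] by (intro mult_right_mono) auto
  also have "\<dots> = (1 - eta1 P) * (c1 * norm (g k) * \<Delta> k)" by simp
  also have "\<dots> \<le> (1 - eta1 P) * m" using m param_bounds by (intro mult_left_mono) auto
  finally have "\<kappa> * (\<Delta> k)\<^sup>2 \<le> (1 - eta1 P) * m" by (simp add: power2_eq_square)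
  moreover have "\<bar>f (x k + s k) - model r (x k) (Y k) (s k)\<bar> \<le> \<kappa> * (\<Delta> k)\<^sup>2"
    using model_error[OF made_poised_Y[OF p]] radii[of k] norm_s_le[of k] by auto
  ultimately have "f (x k + s k) - model r (x k) (Y k) (s k) \<le> (1 - eta1 P) * m" by linarith
  then have "eta1 P * m \<le> f (x k) - f (x k + s k)"
    by (simp add: m_def model_zero algebra_simps)
  then show ?thesis
    using \<open>0 < m\<close> unfolding ratio_def m_def[symmetric] by (simp add: le_divide_eq)
qed

text \<open>After a criticality phase the exit test gives
  \<open>\<Delta> k \<le> mu P * norm (g k)\<close>, so the gradient error is itself at most a
  multiple of \<open>norm (g k)\<close>.\<close>

lemma g_ge:
  assumes "\<epsilon> \<le> \<nu> k"
  shows "min (eps_C P) (\<epsilon> / (1 + \<kappa> * mu P)) \<le> norm (g k)"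
proof (cases rule: start_cases[of k])
  case 1
  then show ?thesis by linarith
next
  case 2
  note cr = criticality_k[OF 2(1)]
  have "\<nu> k \<le> norm (g k) + norm (grad f (x k) - g k)"
    using norm_triangle_ineq[of "g k" "grad f (x k) - g k"] by simp
  also have "norm (grad f (x k) - g k) \<le> \<kappa> * \<Delta> k"
    using grad_error[OF made_poised_Y[OF cr(1)]] radii[of k] by auto
  also have "\<kappa> * \<Delta> k \<le> \<kappa> * (mu P * norm (g k))" using cr(2) \<kappa>_pos by simp
  finally have "\<epsilon> \<le> norm (g k) * (1 + \<kappa> * mu P)" using assms by (simp add: algebra_simps)
  moreover have "0 < 1 + \<kappa> * mu P" using \<kappa>_pos param_bounds by (simp add: add_pos_pos)
  ultimately have "\<epsilon> / (1 + \<kappa> * mu P) \<le> norm (g k)" by (simp add: divide_le_eq)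
  then show ?thesis by linarith
qed

lemma g_ge_const:
  assumes "0 < \<epsilon>"
  obtains e where "0 < e" "\<And>k. \<epsilon> \<le> \<nu> k \<Longrightarrow> e \<le> norm (g k)"
proof
  have "0 < 1 + \<kappa> * mu P" using \<kappa>_pos param_bounds by (simp add: add_pos_pos)
  then show "0 < min (eps_C P) (\<epsilon> / (1 + \<kappa> * mu P))" using assms param_bounds by simp
qed (rule g_ge)

section \<open>Decrease of the objective\<close>

definition success :: "nat \<Rightarrow> bool" where
  "success k \<longleftrightarrow> gamma_S P * \<rho> k \<le> norm (s k) \<and> eta1 P \<le> ratio r (x k) (Y k) (s k)"

lemma x_Suc: "x (Suc k) = (if success k then x k + s k else x k)"
  by (cases rule: step_cases[of k]) (auto simp: success_def)

text \<open>A uniform \<open>e\<close> yields a uniform decrease, while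
  \<open>e = norm (g k)\<close> yields monotonicity.\<close>

lemma success_descent:
  assumes "success k" "0 < e" "e \<le> norm (g k)"
  shows "eta1 P * c1 * e * min (\<Delta> k) (e / \<kappa>_H) \<le> f (x k) - f (x (Suc k))"
proof -
  define m where "m = model r (x k) (Y k) 0 - model r (x k) (Y k) (s k)"
  have "e * min (\<Delta> k) (e / \<kappa>_H) \<le> norm (g k) * min (\<Delta> k) (norm (g k) / \<kappa>_H)"
    using assms radii[of k] \<kappa>_H by (intro mult_mono min.mono divide_right_mono) auto
  then have "c1 * (e * min (\<Delta> k) (e / \<kappa>_H))
      \<le> c1 * (norm (g k) * min (\<Delta> k) (norm (g k) / \<kappa>_H))"
    using c1 by (intro mult_left_mono) auto
  also have "\<dots> \<le> m" using decrease[of k] by (simp add: m_def mult_ac)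
  finally have m: "c1 * (e * min (\<Delta> k) (e / \<kappa>_H)) \<le> m" .
  moreover have "0 < c1 * (e * min (\<Delta> k) (e / \<kappa>_H))"
    using assms c1 radii(8)[of k] \<kappa>_H by (intro mult_pos_pos) auto
  ultimately have "0 < m" by linarith
  have "eta1 P \<le> (f (x k) - f (x k + s k)) / m"
    using assms(1) by (simp add: success_def ratio_def m_def)
  then have "eta1 P * m \<le> f (x k) - f (x k + s k)"
    using \<open>0 < m\<close> by (simp add: pos_le_divide_eq)
  moreover have "eta1 P * (c1 * (e * min (\<Delta> k) (e / \<kappa>_H))) \<le> eta1 P * m"
    using m param_bounds by (intro mult_left_mono) auto
  ultimately show ?thesis using assms(1) by (simp add: x_Suc mult.assoc)
qed

lemma f_decreasing: "f (x (Suc k)) \<le> f (x k)"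
proof (cases "success k")
  case True
  have "0 \<le> eta1 P * c1 * norm (g k) * min (\<Delta> k) (norm (g k) / \<kappa>_H)"
    using param_bounds c1 radii(8)[of k] \<kappa>_H by auto
  then show ?thesis using success_descent[OF True g_pos] by force
qed (simp add: x_Suc)

lemma f_convergent: "convergent (\<lambda>k. f (x k))"
proof -
  have "decseq (\<lambda>k. f (x k))" using f_decreasing by (rule decseq_SucI)
  moreover have "0 \<le> f (x k)" for k by (simp add: objective_def)
  ultimately show ?thesis using decseq_convergent convergentI by metis
qed

subsection \<open>Lower bound on the radii\<close>

text \<open>A short step forces the Cauchy minimum below \<open>\<rho> k\<close>; as
  \<open>\<rho> k \<le> \<Delta> k\<close>, its gradient term must be the small one.\<close>

lemma rho_ge_if_safety:
  assumes "norm (s k) < gamma_S P * \<rho> k" "e \<le> norm (g k)"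
  shows "e / \<kappa>_H \<le> \<rho> k"
proof -
  have "c1 * min (\<Delta> k) (norm (g k) / \<kappa>_H) \<le> norm (s k)" by (rule norm_s_ge)
  also have "\<dots> < gamma_S P * \<rho> k" by (rule assms)
  also have "\<dots> \<le> c1 * \<rho> k" using gamma_S_less radii(4)[of k] by simp
  finally have "min (\<Delta> k) (norm (g k) / \<kappa>_H) < \<rho> k" using c1 by simp
  then have "norm (g k) / \<kappa>_H < \<rho> k" using radii(5)[of k] by linarith
  moreover have "e / \<kappa>_H \<le> norm (g k) / \<kappa>_H" using assms \<kappa>_H by (simp add: divide_right_mono)
  ultimately show ?thesis by linarith
qed

text \<open>If the radius shrank, the round before the last failed its exit test. Its model gradient
  is then small relative to its radius, and so is the gradient error, which forces that radius to be
  large.\<close>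

lemma criticality_radius_ge:
  assumes "criticality P r (x k) (\<Delta>i k) (Y k) (\<Delta> k)" "\<epsilon> \<le> \<nu> k"
  shows "\<Delta> k = \<Delta>i k \<or> omega_C P * (mu P * \<epsilon> / (1 + \<kappa> * mu P)) \<le> \<Delta> k"
proof -
  obtain Z N where N: "N \<ge> 1"
    "\<forall>i\<in>{1..N}. made_poised P (x k) (omega_C P ^ (i - 1) * \<Delta>i k) (Z i)"
    "\<forall>i\<in>{1..<N}. \<not> omega_C P ^ (i - 1) * \<Delta>i k \<le> mu P * norm (model_grad r (x k) (Z i))"
    "\<Delta> k = omega_C P ^ (N - 1) * \<Delta>i k"
    using assms unfolding criticality_def by blast
  show ?thesis
  proof (cases "N = 1")
    case True
    then show ?thesis using N by simp
  next
    case False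
    \<comment> \<open>The last round is \<open>M + 2\<close>, so the failed one is
      \<open>M + 1\<close>, with exponent \<open>M\<close> in its radius.\<close>
    then obtain M where M: "N = Suc (Suc M)" using N(1) by (metis One_nat_def Suc_le_D not0_implies_Suc)
    define D where "D = omega_C P ^ M * \<Delta>i k"
    define h where "h = model_grad r (x k) (Z (Suc M))"
    have pos: "0 < 1 + \<kappa> * mu P" using \<kappa>_pos param_bounds by (simp add: add_pos_pos)
    have Z: "made_poised P (x k) D (Z (Suc M))" using bspec[OF N(2), of "Suc M"] M by (simp add: D_def)
    have h: "mu P * norm h < D" using bspec[OF N(3), of "Suc M"] M by (simp add: D_def h_def)
    have D: "0 < D" "D \<le> Delta_max P"
    proof -
      show "0 < D" using param_bounds radii[of k] by (simp add: D_def)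
      have "D \<le> \<Delta>i k" unfolding D_def
        using param_bounds radii[of k] by (intro mult_left_le_one_le power_le_one) auto
      then show "D \<le> Delta_max P" using radii[of k] by linarith
    qed
    have "\<nu> k \<le> norm h + norm (grad f (x k) - h)"
      using norm_triangle_ineq[of h "grad f (x k) - h"] by simp
    then have "\<epsilon> \<le> norm h + \<kappa> * D" using grad_error[OF Z D] assms(2) by (simp add: h_def)
    then have "mu P * \<epsilon> \<le> mu P * (norm h + \<kappa> * D)" using param_bounds by simp
    also have "\<dots> \<le> D * (1 + \<kappa> * mu P)" using h by (simp add: algebra_simps)
    finally have "mu P * \<epsilon> / (1 + \<kappa> * mu P) \<le> D" using pos by (simp add: divide_le_eq)
    then have "omega_C P * (mu P * \<epsilon> / (1 + \<kappa> * mu P)) \<le> omega_C P * D"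
      using param_bounds by (intro mult_left_mono) auto
    also have "omega_C P * D = \<Delta> k" by (simp add: N(4) M D_def)
    finally show ?thesis by blast
  qed
qed

text \<open>By contraposition of \<open>accept\<close>, rejection on a poised set makes the radius
  exceed \<open>c0 * norm (g k)\<close>. Both terms of the shrunken radius are then bounded below,
  and a reset needs \<open>\<rho> k\<close> to reach the smaller one.\<close>

lemma rho_ge_if_reset:
  assumes "ratio r (x k) (Y k) (s k) < eta1 P" "poised (Lambda P) (Y k) (cball (x k) (\<Delta> k))"
    and "max (min (gamma_dec P * \<Delta> k) (norm (s k))) (\<rho> k) = \<rho> k" and "e \<le> norm (g k)"
  shows "min (gamma_dec P * (c0 * e)) (c1 * min (c0 * e) (e / \<kappa>_H)) \<le> \<rho> k"
proof -
  have "c0 * norm (g k) < \<Delta> k" using accept[OF assms(2)] assms(1) by linarith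
  moreover have "c0 * e \<le> c0 * norm (g k)" using assms(4) c0_pos by simp
  ultimately have D: "c0 * e \<le> \<Delta> k" by linarith
  then have "gamma_dec P * (c0 * e) \<le> gamma_dec P * \<Delta> k"
    using param_bounds by simp
  moreover have "c1 * min (c0 * e) (e / \<kappa>_H) \<le> c1 * min (\<Delta> k) (norm (g k) / \<kappa>_H)"
    using D assms(4) c1 \<kappa>_H by (intro mult_left_mono min.mono divide_right_mono) auto
  ultimately have "min (gamma_dec P * (c0 * e)) (c1 * min (c0 * e) (e / \<kappa>_H))
      \<le> min (gamma_dec P * \<Delta> k) (norm (s k))"
    using norm_s_ge[of k] by linarith
  then show ?thesis using assms(3) by linarith
qed

text \<open>One bound for each half of an iteration, so that \<open>min (\<rho>i K) c\<close>
  propagates by induction.\<close>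

lemma rho_bounded_below:
  assumes "0 < \<epsilon>"
  obtains c where "0 < c"
    "\<And>k. \<epsilon> \<le> \<nu> k \<Longrightarrow> min (\<rho>i k) c \<le> \<rho> k"
    "\<And>k. \<epsilon> \<le> \<nu> k \<Longrightarrow> min (\<rho> k) c \<le> \<rho>i (Suc k)"
proof -
  obtain e where e: "0 < e" "\<And>k. \<epsilon> \<le> \<nu> k \<Longrightarrow> e \<le> norm (g k)"
    using g_ge_const[OF assms] by blast
  \<comment> \<open>\<open>a\<close> covers a criticality phase that shrinks the radius,
    \<open>b1\<close> and \<open>b2\<close> the resets after safety and unsuccessful steps; a reset
    multiplies \<rho> by \<open>alpha1 P\<close>.\<close>
  define a where "a = omega_C P * (mu P * \<epsilon> / (1 + \<kappa> * mu P))"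
  define b1 where "b1 = e / \<kappa>_H"
  define b2 where "b2 = min (gamma_dec P * (c0 * e)) (c1 * min (c0 * e) (e / \<kappa>_H))"
  define c where "c = min a (alpha1 P * min b1 b2)"
  have pos: "0 < 1 + \<kappa> * mu P" using \<kappa>_pos param_bounds by (simp add: add_pos_pos)
  then have "0 < a" using assms param_bounds by (simp add: a_def)
  moreover have "0 < b1" "0 < b2"
    using e c0_pos c1 \<kappa>_H param_bounds by (simp_all add: b1_def b2_def)
  ultimately have "0 < c" using param_bounds by (simp add: c_def)
  show ?thesis
  proof
    show "0 < c" by fact
    fix k assume k: "\<epsilon> \<le> \<nu> k"
    show "min (\<rho>i k) c \<le> \<rho> k"
    proof (cases rule: start_cases[of k])
      case 2
      then show ?thesis
        using criticality_radius_ge[OF 2(1) k, folded a_def] radii[of k] by (auto simp: c_def)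
    qed auto
    have reset: "min (\<rho> k) c \<le> u"
      if "(u, v) = reset_radii P (\<rho> k) D" "D = \<rho> k \<Longrightarrow> min b1 b2 \<le> \<rho> k" for u v D
    proof (cases "D = \<rho> k")
      case True
      then have "alpha1 P * min b1 b2 \<le> alpha1 P * \<rho> k"
        using that(2) param_bounds by (intro mult_left_mono) auto
      moreover have "u = alpha1 P * \<rho> k" using that True by (simp add: reset_radii_def)
      ultimately show ?thesis unfolding c_def by linarith
    next
      case False
      then show ?thesis using that by (simp add: reset_radii_def)
    qed
    show "min (\<rho> k) c \<le> \<rho>i (Suc k)"
    proof (cases rule: step_cases[of k])
      case safety
      show ?thesis
        by (rule reset[OF safety(4)])
          (use rho_ge_if_safety[OF safety(1) e(2)[OF k]] in \<open>simp add: b1_def min.coboundedI1\<close>)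
    next
      case unsuccessful
      show ?thesis
        by (rule reset[OF unsuccessful(5)])
          (use rho_ge_if_reset[OF unsuccessful(2,4) _ e(2)[OF k], folded b2_def]
            in \<open>simp add: min.coboundedI2\<close>)
    qed auto
  qed
qed

subsection \<open>Convergence\<close>

definition \<theta> :: real where
  "\<theta> = max (alpha1 P) (max (omega_S P) (gamma_dec P))"

lemma \<theta>_bounds: "0 < \<theta>" "\<theta> < 1"
  using param_bounds by (auto simp: \<theta>_def)

text \<open>A reset scales \<rho> by \<open>alpha1 P\<close>; otherwise the radius shrinks. Either
  way one factor contracts by \<theta> and the other does not grow.\<close>

lemma reset_radii_product_le:
  assumes "(a, b) = reset_radii P (\<rho> k) D" "D = \<rho> k \<or> D \<le> \<theta> * \<Delta> k"
  shows "a * b \<le> \<theta> * (\<rho>i k * \<Delta>i k)"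
proof -
  note rad = radii[of k]
  have "\<rho> k * \<Delta> k \<le> \<rho>i k * \<Delta>i k" using rad by (intro mult_mono) auto
  then have le: "\<theta> * (\<rho> k * \<Delta> k) \<le> \<theta> * (\<rho>i k * \<Delta>i k)" using \<theta>_bounds by simp
  have "a * b \<le> \<theta> * (\<rho> k * \<Delta> k)"
  proof (cases "D = \<rho> k")
    case True
    then have "a = alpha1 P * \<rho> k" "b = alpha2 P * \<rho> k" using assms by (simp_all add: reset_radii_def)
    moreover have "alpha2 P * \<rho> k \<le> \<Delta> k"
      using param_bounds rad mult_left_le_one_le[of "\<rho> k" "alpha2 P"] by linarith
    moreover have "alpha1 P * \<rho> k \<le> \<theta> * \<rho> k"
      using rad by (intro mult_right_mono) (auto simp: \<theta>_def)
    ultimately have "a * b \<le> (\<theta> * \<rho> k) * \<Delta> k"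
      using param_bounds rad \<theta>_bounds by (intro mult_mono) auto
    then show ?thesis by (simp add: mult_ac)
  next
    case False
    then have "a = \<rho> k" "b = D" "D \<le> \<theta> * \<Delta> k" using assms by (simp_all add: reset_radii_def)
    then show ?thesis using mult_left_mono[of D "\<theta> * \<Delta> k" "\<rho> k"] rad by (simp add: mult_ac)
  qed
  then show ?thesis using le by linarith
qed

lemma omega_gamma_le_\<theta>:
  "omega_S P * \<Delta> k \<le> \<theta> * \<Delta> k" "gamma_dec P * \<Delta> k \<le> \<theta> * \<Delta> k"
  using radii(8)[of k] by (auto simp: \<theta>_def)

text \<open>Only safety and unsuccessful steps remain: the tentative radius is
  \<open>\<rho> k\<close>, which triggers a reset, or at most \<theta> times the radius.\<close>

lemma product_contracts:
  assumes "\<not> success k" "poised (Lambda P) (Y k) (cball (x k) (\<Delta> k)) \<or> norm (s k) < gamma_S P * \<rho> k"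
  shows "\<rho>i (Suc k) * \<Delta>i (Suc k) \<le> \<theta> * (\<rho>i k * \<Delta>i k)"
proof (cases rule: step_cases[of k])
  case safety
  show ?thesis
    by (rule reset_radii_product_le[OF safety(4)])
      (use omega_gamma_le_\<theta>[of k] in \<open>unfold max_def, presburger\<close>)
next
  case unsuccessful
  show ?thesis
    by (rule reset_radii_product_le[OF unsuccessful(5)])
      (use omega_gamma_le_\<theta>[of k] in linarith)
qed (use assms in \<open>auto simp: success_def\<close>)

lemma product_nonincreasing:
  assumes "\<not> success k"
  shows "\<rho>i (Suc k) * \<Delta>i (Suc k) \<le> \<rho>i k * \<Delta>i k"
proof (cases "poised (Lambda P) (Y k) (cball (x k) (\<Delta> k)) \<or> norm (s k) < gamma_S P * \<rho> k")
  case True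
  moreover have "\<theta> * (\<rho>i k * \<Delta>i k) \<le> \<rho>i k * \<Delta>i k"
    using \<theta>_bounds radii[of k] by (intro mult_left_le_one_le) auto
  ultimately show ?thesis using product_contracts[OF assms] by linarith
next
  case False
  \<comment> \<open>Only a model-improving iteration remains: it keeps \<rho>, and its radius may
    reach \<open>\<rho> k\<close> without a reset.\<close>
  have "gamma_dec P * \<Delta> k \<le> \<Delta> k"
    using param_bounds radii[of k] by (intro mult_left_le_one_le) auto
  then have "\<rho>i (Suc k) = \<rho> k" "\<Delta>i (Suc k) \<le> \<Delta> k"
    using False assms radii(5)[of k]
    by (cases rule: step_cases[of k]; force simp: success_def)+
  then show ?thesis using radii[of k] radii(1,2)[of "Suc k"] by (auto intro!: mult_mono)
qed

text \<open>After a model-improving iteration the set is poised in the next, possibly smaller,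
  trust region, so two such iterations are never consecutive.\<close>

lemma product_contracts_two_steps:
  assumes "\<not> success k" "\<not> success (Suc k)"
  shows "\<rho>i (Suc (Suc k)) * \<Delta>i (Suc (Suc k)) \<le> \<theta> * (\<rho>i k * \<Delta>i k)"
proof (cases "poised (Lambda P) (Y k) (cball (x k) (\<Delta> k)) \<or> norm (s k) < gamma_S P * \<rho> k")
  case True
  then show ?thesis
    using product_contracts[OF assms(1)] product_nonincreasing[OF assms(2)] by linarith
next
  case False
  then have Yi: "made_poised P (x (Suc k)) (\<Delta>i (Suc k)) (Yi (Suc k))"
    using assms by (cases rule: step_cases[of k]) (auto simp: success_def)
  have "poised (Lambda P) (Y (Suc k)) (cball (x (Suc k)) (\<Delta> (Suc k)))"
  proof (cases rule: start_cases[of "Suc k"])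
    case 1
    then show ?thesis using Yi by (simp add: made_poised_def)
  next
    case 2
    then show ?thesis using criticality_k(1) by blast
  qed
  then have "\<rho>i (Suc (Suc k)) * \<Delta>i (Suc (Suc k)) \<le> \<theta> * (\<rho>i (Suc k) * \<Delta>i (Suc k))"
    using product_contracts[OF assms(2)] by blast
  also have "\<dots> \<le> \<theta> * (\<rho>i k * \<Delta>i k)"
    using product_nonincreasing[OF assms(1)] \<theta>_bounds by simp
  finally show ?thesis .
qed

lemma frequently_small_grad:
  assumes "0 < \<epsilon>"
  shows "\<exists>k\<ge>K. \<nu> k < \<epsilon>"
proof (rule ccontr)
  assume "\<not> ?thesis"
  then have \<nu>: "\<epsilon> \<le> \<nu> k" if "K \<le> k" for k using that by force
  obtain e where e: "0 < e" "\<And>k. \<epsilon> \<le> \<nu> k \<Longrightarrow> e \<le> norm (g k)"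
    using g_ge_const[OF assms] by blast
  obtain c where c: "0 < c" "\<And>k. \<epsilon> \<le> \<nu> k \<Longrightarrow> min (\<rho>i k) c \<le> \<rho> k"
    "\<And>k. \<epsilon> \<le> \<nu> k \<Longrightarrow> min (\<rho> k) c \<le> \<rho>i (Suc k)"
    using rho_bounded_below[OF assms] by blast
  \<comment> \<open>A lower bound for all later \<open>\<rho>i k\<close>, obtained by induction
    through both halves of each iteration.\<close>
  define R where "R = min (\<rho>i K) c"
  have "0 < R" using c(1) radii(1)[of K] by (simp add: R_def)
  have \<rho>i: "R \<le> \<rho>i k" if "K \<le> k" for k
    using that
  proof (induction k rule: dec_induct)
    case (step k)
    then show ?case using c(2,3)[OF \<nu>[of k]] by (simp add: R_def)
  qed (simp add: R_def)
  \<comment> \<open>Each later success decreases the objective by at least \<open>a\<close>; since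
    the objective values converge, successes eventually stop.\<close>
  define a where "a = eta1 P * c1 * e * min R (e / \<kappa>_H)"
  have "0 < a" using param_bounds c1 e \<kappa>_H \<open>0 < R\<close> by (simp add: a_def)
  have drop: "a \<le> f (x k) - f (x (Suc k))" if "K \<le> k" "success k" for k
  proof -
    have "R \<le> \<Delta> k" using \<rho>i[OF that(1)] c(2)[OF \<nu>[OF that(1)]] radii[of k] by (simp add: R_def)
    then have "a \<le> eta1 P * c1 * e * min (\<Delta> k) (e / \<kappa>_H)"
      unfolding a_def using param_bounds c1 e by (intro mult_left_mono) auto
    also have "\<dots> \<le> f (x k) - f (x (Suc k))"
      using success_descent[OF that(2) e(1) e(2)[OF \<nu>[OF that(1)]]] .
    finally show ?thesis .
  qed
  have "(\<lambda>k. f (x k) - f (x (Suc k))) \<longlonglongrightarrow> 0"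
  proof -
    obtain l where l: "(\<lambda>k. f (x k)) \<longlonglongrightarrow> l" using f_convergent convergentD by blast
    from tendsto_diff[OF l LIMSEQ_Suc[OF l]] show ?thesis by simp
  qed
  then have "\<forall>\<^sub>F k in sequentially. f (x k) - f (x (Suc k)) < a"
    using \<open>0 < a\<close> by (rule order_tendstoD)
  then obtain K' where K': "\<And>k. K' \<le> k \<Longrightarrow> f (x k) - f (x (Suc k)) < a"
    unfolding eventually_sequentially by blast
  define M where "M = max K K'"
  have ns: "\<not> success k" if "M \<le> k" for k
    using drop[of k] K'[of k] that by (auto simp: M_def)
  \<comment> \<open>The index advances by two because a contraction is guaranteed only over two
    consecutive iterations.\<close>
  have contr: "\<rho>i (M + 2 * n) * \<Delta>i (M + 2 * n) \<le> \<theta> ^ n * (\<rho>i M * \<Delta>i M)" for n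
  proof (induction n)
    case (Suc n)
    have "\<rho>i (M + 2 * Suc n) * \<Delta>i (M + 2 * Suc n) \<le> \<theta> * (\<rho>i (M + 2 * n) * \<Delta>i (M + 2 * n))"
      using product_contracts_two_steps[of "M + 2 * n"] ns by simp
    also have "\<dots> \<le> \<theta> * (\<theta> ^ n * (\<rho>i M * \<Delta>i M))"
      using Suc \<theta>_bounds by simp
    finally show ?case by (simp add: mult_ac)
  qed simp
  have "R * R \<le> \<theta> ^ n * (\<rho>i M * \<Delta>i M)" for n
  proof -
    have "R * R \<le> \<rho>i (M + 2 * n) * \<Delta>i (M + 2 * n)"
    proof (intro mult_mono)
      show "R \<le> \<rho>i (M + 2 * n)" by (rule \<rho>i) (simp add: M_def)
      then show "R \<le> \<Delta>i (M + 2 * n)" using radii(2) order_trans by blast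
    qed (use radii(1)[of "M + 2 * n"] \<open>0 < R\<close> in auto)
    then show ?thesis using contr[of n] by linarith
  qed
  moreover have "(\<lambda>n. \<theta> ^ n * (\<rho>i M * \<Delta>i M)) \<longlonglongrightarrow> 0 * (\<rho>i M * \<Delta>i M)"
    using \<theta>_bounds by (intro tendsto_mult tendsto_const LIMSEQ_power_zero) auto
  ultimately have "R * R \<le> 0"
    by (simp add: LIMSEQ_le_const)
  then show False using \<open>0 < R\<close> by (simp add: mult_le_0_iff)
qed

section \<open>Lipschitz continuity of the gradient\<close>

lemma r_lipschitz:
  assumes "y \<in> \<B>" "z \<in> \<B>"
  shows "norm (r y - r z) \<le> J_max * norm (y - z)"
proof (rule differentiable_bound[OF convex_B _ _ assms])
  fix w assume "w \<in> \<B>"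
  show "(r has_derivative (*v) (J w)) (at w within \<B>)"
    using r_diff jacobian_works has_derivative_at_withinI by blast
  show "onorm ((*v) (J w)) \<le> J_max" using J_bound[OF \<open>w \<in> \<B>\<close>] by (simp add: spec_norm_eq_onorm)
qed

lemma J_max_nonneg: "0 \<le> J_max"
  using J_bound[OF x_in_B[of 0]] onorm_pos_le[of "(*v) (J (x 0))"]
  by (simp add: spec_norm_eq_onorm)

text \<open>Adding and subtracting \<open>transpose (J z) *v r y\<close> separates the variation of
  the Jacobian from that of the residual.\<close>

lemma grad_lipschitz:
  assumes "y \<in> \<B>" "z \<in> \<B>"
  shows "norm (grad f y - grad f z) \<le> (L * r_max + J_max\<^sup>2) * norm (y - z)"
proof -
  have "grad f y - grad f z = transpose (J y - J z) *v r y + transpose (J z) *v (r y - r z)"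
    by (simp add: grad_objective[OF r_diff] transpose_def matrix_vector_mult_def vec_eq_iff
        left_diff_distrib right_diff_distrib sum_subtractf)
  also have "norm \<dots> \<le> L * norm (y - z) * r_max + J_max * (J_max * norm (y - z))"
  proof (rule norm_triangle_mono)
    have "norm (transpose (J y - J z) *v r y) \<le> spec_norm (J y - J z) * norm (r y)"
      by (intro norm_transpose_vector_le norm_matrix_vector_le_spec_norm)
    also have "\<dots> \<le> L * norm (y - z) * r_max"
      using J_lipschitz[OF assms] r_bound[OF assms(1)] L_nonneg by (intro mult_mono) auto
    finally show "norm (transpose (J y - J z) *v r y) \<le> L * norm (y - z) * r_max" .
    have "norm (transpose (J z) *v (r y - r z)) \<le> spec_norm (J z) * norm (r y - r z)"
      by (intro norm_transpose_vector_le norm_matrix_vector_le_spec_norm)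
    also have "\<dots> \<le> J_max * (J_max * norm (y - z))"
      using J_bound[OF assms(2)] r_lipschitz[OF assms] J_max_nonneg by (intro mult_mono) auto
    finally show "norm (transpose (J z) *v (r y - r z)) \<le> J_max * (J_max * norm (y - z))" .
  qed
  finally show ?thesis by (simp add: power2_eq_square algebra_simps)
qed

text \<open>Iterates move only on success. There \<open>small\<close> excludes the term
  \<open>e / \<kappa>_H\<close> from the Cauchy minimum, so the decrease is at least
  \<open>a\<close> times the radius, hence the step length; the sum telescopes.\<close>

lemma path_length_le:
  assumes "0 < a" "0 < e" "a = eta1 P * c1 * e" "t \<le> l"
    and g: "\<And>k. t \<le> k \<Longrightarrow> k < l \<Longrightarrow> e \<le> norm (g k)"
    and small: "\<And>k. t \<le> k \<Longrightarrow> f (x k) - f (x (Suc k)) < a * (e / \<kappa>_H)"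
  shows "a * norm (x l - x t) \<le> f (x t) - f (x l)"
  using \<open>t \<le> l\<close> g
proof (induction l rule: dec_induct)
  case (step k)
  have "a * norm (x (Suc k) - x k) \<le> f (x k) - f (x (Suc k))"
  proof (cases "success k")
    case True
    have "a * min (\<Delta> k) (e / \<kappa>_H) \<le> f (x k) - f (x (Suc k))"
      using success_descent[OF True \<open>0 < e\<close>] step by (simp add: assms(3))
    moreover from this have "a * min (\<Delta> k) (e / \<kappa>_H) < a * (e / \<kappa>_H)"
      using small[OF step(1)] by linarith
    then have "min (\<Delta> k) (e / \<kappa>_H) = \<Delta> k" using \<open>0 < a\<close> by (simp add: min_def split: if_splits)
    moreover have "a * norm (x (Suc k) - x k) \<le> a * \<Delta> k"
      using True norm_s_le[of k] \<open>0 < a\<close> by (simp add: x_Suc)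
    ultimately show ?thesis by simp
  qed (simp add: x_Suc)
  moreover have "a * norm (x k - x t) \<le> f (x t) - f (x k)" using step by simp
  moreover have "a * norm (x (Suc k) - x t) \<le> a * norm (x (Suc k) - x k) + a * norm (x k - x t)"
    using norm_triangle_ineq[of "x (Suc k) - x k" "x k - x t"] \<open>0 < a\<close>
    by (simp flip: distrib_left)
  ultimately show ?case by linarith
qed simp

lemma grad_tendsto_0: "\<nu> \<longlonglongrightarrow> 0"
proof (rule ccontr)
  assume "\<not> \<nu> \<longlonglongrightarrow> 0"
  then obtain \<epsilon>' where \<epsilon>': "0 < \<epsilon>'" "\<And>K. \<exists>k\<ge>K. \<epsilon>' \<le> \<nu> k"
    unfolding LIMSEQ_iff by (force simp: not_less)
  \<comment> \<open>Half the level, so the gradient norm must drop by more than \<epsilon> between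
    \<open>t\<close> and \<open>l\<close>.\<close>
  define \<epsilon> where "\<epsilon> = \<epsilon>' / 2"
  have "0 < \<epsilon>" using \<epsilon>' by (simp add: \<epsilon>_def)
  obtain e where e: "0 < e" "\<And>k. \<epsilon> \<le> \<nu> k \<Longrightarrow> e \<le> norm (g k)"
    using g_ge_const[OF \<open>0 < \<epsilon>\<close>] by blast
  define a where "a = eta1 P * c1 * e"
  have "0 < a" using param_bounds c1 e by (simp add: a_def)
  define G where "G = L * r_max + J_max\<^sup>2"
  have "0 \<le> G" using L_nonneg r_max_nonneg by (simp add: G_def)
  \<comment> \<open>The first term supplies \<open>small\<close> in \<open>path_length_le\<close>;
    the second keeps \<open>x l\<close> within \<open>\<epsilon> / (G + 1)\<close> of
    \<open>x t\<close>. The \<open>+ 1\<close> guards against \<open>G = 0\<close>.\<close>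
  define d where "d = min (a * (e / \<kappa>_H)) (a * (\<epsilon> / (G + 1)))"
  have "0 < d" using \<open>0 < a\<close> e \<kappa>_H \<open>0 < \<epsilon>\<close> \<open>0 \<le> G\<close> by (simp add: d_def)
  have "Cauchy (\<lambda>k. f (x k))" using f_convergent by (rule convergent_Cauchy)
  then obtain K where K: "\<And>m n. K \<le> m \<Longrightarrow> K \<le> n \<Longrightarrow> norm (f (x m) - f (x n)) < d"
    using \<open>0 < d\<close> unfolding Cauchy_iff by blast
  obtain t where t: "K \<le> t" "\<epsilon>' \<le> \<nu> t" using \<epsilon>'(2) by blast
  \<comment> \<open>The first index from \<open>t\<close> on with a small gradient; minimality keeps
    the gradients before it at least \<epsilon>, so the model gradients are bounded below
    there.\<close>
  define l where "l = (LEAST l. t \<le> l \<and> \<nu> l < \<epsilon>)"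
  have "\<exists>l. t \<le> l \<and> \<nu> l < \<epsilon>" using frequently_small_grad[OF \<open>0 < \<epsilon>\<close>, of t] by blast
  then have l: "t \<le> l" "\<nu> l < \<epsilon>" unfolding l_def by (metis (mono_tags, lifting) LeastI)+
  have before: "\<epsilon> \<le> \<nu> k" if "t \<le> k" "k < l" for k
    using not_less_Least[of k "\<lambda>l. t \<le> l \<and> \<nu> l < \<epsilon>"] that by (auto simp: l_def)
  have "a * norm (x l - x t) \<le> f (x t) - f (x l)"
  proof (rule path_length_le[OF \<open>0 < a\<close> e(1) a_def l(1)])
    fix k assume "t \<le> k"
    then show "f (x k) - f (x (Suc k)) < a * (e / \<kappa>_H)"
      using K[of k "Suc k"] t unfolding d_def by auto
  qed (use e(2) before in blast)
  also have "\<dots> < a * (\<epsilon> / (G + 1))" using K[of t l] t l unfolding d_def by auto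
  finally have "norm (x l - x t) < \<epsilon> / (G + 1)"
    using \<open>0 < a\<close> by (simp only: mult_less_cancel_left_pos)
  then have "norm (x t - x l) * (G + 1) < \<epsilon>"
    using \<open>0 \<le> G\<close> by (simp add: pos_less_divide_eq norm_minus_commute)
  moreover have "norm (grad f (x t) - grad f (x l)) \<le> G * norm (x t - x l)"
    unfolding G_def by (intro grad_lipschitz x_in_B)
  ultimately have "norm (grad f (x t) - grad f (x l)) < \<epsilon>"
    using norm_ge_zero[of "x t - x l"] unfolding distrib_left mult.commute[of G] by linarith
  moreover have "\<nu> t \<le> \<nu> l + norm (grad f (x t) - grad f (x l))"
    using norm_triangle_ineq[of "grad f (x l)" "grad f (x t) - grad f (x l)"] by simp
  ultimately show False using t(2) l(2) by (simp add: \<epsilon>_def)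
qed

end

theorem theorem3p13:
  fixes r :: "real^'n \<Rightarrow> real^'m"
    and P :: dfogn_params
    and x s :: "nat \<Rightarrow> real^'n"
    and Yi Y :: "nat \<Rightarrow> (real^'n) set"
    and \<rho>i \<Delta>i \<rho> \<Delta> :: "nat \<Rightarrow> real"
    and c1 L_J r_max J_max \<kappa>_H :: real
    and \<B> :: "(real^'n) set"
  defines "\<B> \<equiv> convex hull (\<Union>k. cball (x k) (Delta_max P))"
  assumes params: "valid_params P c1"
    and run: "dfogn_run P r x Yi \<rho>i \<Delta>i Y \<rho> \<Delta> s"
    and c1: "1/2 \<le> c1" "c1 \<le> 1"
    and decrease: "\<And>k. model r (x k) (Y k) 0 - model r (x k) (Y k) (s k)
        \<ge> c1 * norm (model_grad r (x k) (Y k)) *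
            min (\<Delta> k) (norm (model_grad r (x k) (Y k)) / max (spec_norm (model_hess r (x k) (Y k))) 1)"
    and r_C1: "\<And>z. r differentiable (at z)" "continuous_on UNIV (\<lambda>z. jacobian r (at z))"
    and J_lipschitz: "\<And>y z. y \<in> \<B> \<Longrightarrow> z \<in> \<B> \<Longrightarrow>
        spec_norm (jacobian r (at y) - jacobian r (at z)) \<le> L_J * norm (y - z)"
    and r_bound: "\<And>z. z \<in> \<B> \<Longrightarrow> norm (r z) \<le> r_max"
    and J_bound: "\<And>z. z \<in> \<B> \<Longrightarrow> spec_norm (jacobian r (at z)) \<le> J_max"
    and \<kappa>_H: "1 \<le> \<kappa>_H" "\<And>k. spec_norm (model_hess r (x k) (Y k)) \<le> \<kappa>_H"
  shows "(\<lambda>k. norm (grad (objective r) (x k))) \<longlonglongrightarrow> 0"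
proof -
  \<comment> \<open>The absolute value supplies the nonnegative Lipschitz constant of the
    locale.\<close>
  interpret dfogn r P x s Yi Y \<rho>i \<Delta>i \<rho> \<Delta> c1 "\<bar>L_J\<bar>" r_max J_max \<kappa>_H \<B>
  proof
    show "c1 * norm (model_grad r (x k) (Y k)) * min (\<Delta> k) (norm (model_grad r (x k) (Y k)) / \<kappa>_H)
        \<le> model r (x k) (Y k) 0 - model r (x k) (Y k) (s k)" for k
    proof (rule order_trans[OF _ decrease])
      let ?h = "max (spec_norm (model_hess r (x k) (Y k))) 1"
      \<comment> \<open>\<kappa>_H dominates both entries of \<open>?h\<close>, so using it instead
        only weakens the Cauchy decrease.\<close>
      have "norm (model_grad r (x k) (Y k)) / \<kappa>_H \<le> norm (model_grad r (x k) (Y k)) / ?h"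
        using \<kappa>_H by (intro divide_left_mono) auto
      then show "c1 * norm (model_grad r (x k) (Y k)) *
            min (\<Delta> k) (norm (model_grad r (x k) (Y k)) / \<kappa>_H)
          \<le> c1 * norm (model_grad r (x k) (Y k)) *
            min (\<Delta> k) (norm (model_grad r (x k) (Y k)) / ?h)"
        using c1 by (intro mult_left_mono) auto
    qed
    show "cball (x k) (Delta_max P) \<subseteq> \<B>" for k
      unfolding \<B>_def by (rule order_trans[OF _ hull_subset]) blast
    show "spec_norm (jacobian r (at y) - jacobian r (at z)) \<le> \<bar>L_J\<bar> * norm (y - z)"
      if "y \<in> \<B>" "z \<in> \<B>" for y z
      using J_lipschitz[OF that] mult_right_mono[OF abs_ge_self[of L_J] norm_ge_zero[of "y - z"]]
      by linarith
  qed (use params run c1 r_C1(1) r_bound J_bound \<kappa>_H(1) in \<open>auto simp: \<B>_def\<close>)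
  show ?thesis by (rule grad_tendsto_0)
qed

end
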